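(* Let $X$ be a mean-zero random vector in $\mathbb R^p$ (not almost surely zero). If $\mathbb E[\|X\|^{4+4\tau}]<\infty$ for some constant $0<\tau\le1/2$, then $$\big|\mathcal V^2(X)-B_X^{-1}\,\mathbb E[(X_1^TX_2)^2]\big|\le 9\,B_X^{-(1+2\tau)}L_{x,\tau}.$$
   Context: $\|\cdot\|$ is the Euclidean norm; $X_1,X_2$ are i.i.d. copies of $X$. $d(X_1,X_2)=\|X_1-X_2\|-\mathbb E[\|X_1-X_2\|\mid X_1]-\mathbb E[\|X_1-X_2\|\mid X_2]+\mathbb E\|X_1-X_2\|$ and $\mathcal V^2(X)=\mathbb E[d(X_1,X_2)^2]$. $B_X=\mathbb E\|X_1-X_2\|^2=2\,\mathbb E\|X\|^2$. $L_{x,\tau}=\mathbb E\big(\big|\|X\|^2-\mathbb E\|X\|^2\big|^{2+2\tau}\big)+\mathbb E\big(|X_1^TX_2|^{2+2\tau}\big)$. *)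

theory Defs
  imports "HOL-Probability.Probability"
begin

text \<open>Conditional expectation of \<open>f\<close> given the random vector \<open>Y\<close>, that is, given the
  sigma-algebra generated by \<open>Y\<close>; it is determined up to null sets only.\<close>

definition cond_exp_given ::
    "'a measure \<Rightarrow> ('a \<Rightarrow> 'b::topological_space) \<Rightarrow> ('a \<Rightarrow> real) \<Rightarrow> 'a \<Rightarrow> real" where
  "cond_exp_given M Y f = real_cond_exp M (vimage_algebra (space M) Y borel) f"

definition iid_copies ::
    "'a measure \<Rightarrow> ('a \<Rightarrow> 'c::topological_space) \<Rightarrow> 'b measure \<Rightarrow> ('b \<Rightarrow> 'c) \<Rightarrow> ('b \<Rightarrow> 'c) \<Rightarrow> bool" where
  "iid_copies M X N X1 X2 \<longleftrightarrow>
     prob_space N \<and>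
     prob_space.indep_var N borel X1 borel X2 \<and>
     distr N borel X1 = distr M borel X \<and>
     distr N borel X2 = distr M borel X"

definition centered_dist ::
    "'b measure \<Rightarrow> ('b \<Rightarrow> real ^ 'p) \<Rightarrow> ('b \<Rightarrow> real ^ 'p) \<Rightarrow> 'b \<Rightarrow> real" where
  "centered_dist N X1 X2 \<omega> =
     norm (X1 \<omega> - X2 \<omega>)
     - cond_exp_given N X1 (\<lambda>\<omega>'. norm (X1 \<omega>' - X2 \<omega>')) \<omega>
     - cond_exp_given N X2 (\<lambda>\<omega>'. norm (X1 \<omega>' - X2 \<omega>')) \<omega>
     + (\<integral>\<omega>'. norm (X1 \<omega>' - X2 \<omega>') \<partial>N)"

text \<open>The next three quantities are expressed through a chosen pair \<open>X1, X2\<close> of i.i.d. copies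
  of \<open>X\<close>; their values depend only on the law of \<open>X\<close>.\<close>

definition dist_variance_sq ::
    "'b measure \<Rightarrow> ('b \<Rightarrow> real ^ 'p) \<Rightarrow> ('b \<Rightarrow> real ^ 'p) \<Rightarrow> real" where
  "dist_variance_sq N X1 X2 = (\<integral>\<omega>. (centered_dist N X1 X2 \<omega>)\<^sup>2 \<partial>N)"

definition mean_sq_dist ::
    "'b measure \<Rightarrow> ('b \<Rightarrow> real ^ 'p) \<Rightarrow> ('b \<Rightarrow> real ^ 'p) \<Rightarrow> real" where
  "mean_sq_dist N X1 X2 = (\<integral>\<omega>. (norm (X1 \<omega> - X2 \<omega>))\<^sup>2 \<partial>N)"

definition moment_L ::
    "'a measure \<Rightarrow> ('a \<Rightarrow> real ^ 'p) \<Rightarrow> 'b measure \<Rightarrow> ('b \<Rightarrow> real ^ 'p) \<Rightarrow> ('b \<Rightarrow> real ^ 'p)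
      \<Rightarrow> real \<Rightarrow> real" where
  "moment_L M X N X1 X2 \<tau> =
     (\<integral>\<omega>. \<bar>(norm (X \<omega>))\<^sup>2 - (\<integral>\<omega>'. (norm (X \<omega>'))\<^sup>2 \<partial>M)\<bar> powr (2 + 2 * \<tau>) \<partial>M)
     + (\<integral>\<omega>. \<bar>X1 \<omega> \<bullet> X2 \<omega>\<bar> powr (2 + 2 * \<tau>) \<partial>N)"

end

theory Submission
  imports Defs
begin

text \<open>After rescaling we may assume \<open>B = 1\<close>, that is \<open>E |X|\<^sup>2 = 1/2\<close>. For independent copies \<open>x, y\<close>
  put \<open>u = |x|\<^sup>2 - 1/2\<close>, \<open>v = |y|\<^sup>2 - 1/2\<close>, \<open>p = x \<bullet> y\<close> and \<open>s = |x - y|\<close>, so that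
  \<open>s\<^sup>2 = 1 + u + v - 2 p\<close> and \<open>s = 1 + (u + v) / 2 - p - (1 - s)\<^sup>2 / 2\<close>. Double centering \<open>D\<close> is the
  orthogonal projection of \<open>L\<^sup>2\<close> that kills functions of one variable, and \<open>D p = p\<close>.

  Lower bound: \<open>0 \<le> E (D s + p)\<^sup>2\<close> gives \<open>E (D s)\<^sup>2 - E p\<^sup>2 \<ge> E [p (1 - s)\<^sup>2]\<close>.
  Upper bound: \<open>E (D s)\<^sup>2 \<le> E (s - \<phi> x - \<phi> y)\<^sup>2\<close> for every \<open>\<phi>\<close>, and to the square one may add
  \<open>2 (u\<^sub>- \<^sup>2 v + v\<^sub>- \<^sup>2 u)\<close>, which has mean zero. The choice \<open>\<phi> = (1 + u) / 2\<close> would only give a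
  constant above 16, because of pairs with \<open>x\<close> close to \<open>y\<close>; subtracting the correction
  \<open>u\<^sub>- \<^sup>2 (4 + 6 u)\<close> from \<open>\<phi>\<close> brings it below 9. Both bounds then hold pointwise,
  with \<open>min (r\<^sup>2) (r\<^sup>3)\<close> in place of \<open>r powr (2 + 2 \<tau>)\<close>.\<close>

section \<open>The pointwise inequalities\<close>


text \<open>The pointwise infimum of \<open>\<bar>x\<bar> powr q\<close> over
  \<open>2 \<le> q \<le> 3\<close>, so a single bound serves every exponent
  \<open>2 + 2 * \<tau>\<close> with \<open>0 < \<tau> \<le> 1/2\<close>.\<close>

definition cubic_min :: "real \<Rightarrow> real" where
  "cubic_min x = min (x\<^sup>2) (\<bar>x\<bar> ^ 3)"

lemma cubic_min_small: "\<bar>x\<bar> \<le> 1 \<Longrightarrow> cubic_min x = \<bar>x\<bar> ^ 3"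
proof -
  assume "\<bar>x\<bar> \<le> 1"
  then have "\<bar>x\<bar>\<^sup>2 * \<bar>x\<bar> \<le> \<bar>x\<bar>\<^sup>2 * 1" by (intro mult_left_mono) auto
  then show ?thesis by (simp add: cubic_min_def power3_eq_cube power2_eq_square min_def)
qed

lemma cubic_min_large: "1 \<le> \<bar>x\<bar> \<Longrightarrow> cubic_min x = x\<^sup>2"
proof -
  assume "1 \<le> \<bar>x\<bar>"
  then have "\<bar>x\<bar>\<^sup>2 * 1 \<le> \<bar>x\<bar>\<^sup>2 * \<bar>x\<bar>" by (intro mult_left_mono) auto
  then show ?thesis by (simp add: cubic_min_def power3_eq_cube power2_eq_square min_def)
qed

lemma cubic_min_nonneg [simp]: "0 \<le> cubic_min x"
  by (simp add: cubic_min_def)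

lemma cubic_min_minus [simp]: "cubic_min (- x) = cubic_min x"
  by (simp add: cubic_min_def)

lemma cubic_min_abs [simp]: "cubic_min \<bar>x\<bar> = cubic_min x"
  by (simp add: cubic_min_def)

lemma le_cubic_minI:
  assumes "0 \<le> M" "0 \<le> k" "M \<le> 1 \<Longrightarrow> G \<le> k * M ^ 3" "1 \<le> M \<Longrightarrow> G \<le> k * M\<^sup>2"
  shows "G \<le> k * cubic_min M"
  using assms cubic_min_small[of M] cubic_min_large[of M] by (cases "M \<le> 1") auto

text \<open>The coefficients 4 and 6, and the weight 2 of the \<open>neg_sq\<close> terms in \<open>pointwise_upper\<close>,
  were found numerically.\<close>

definition corr :: "real \<Rightarrow> real" where
  "corr u = (if u < 0 then u\<^sup>2 * (4 + 6 * u) else 0)"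

definition neg_sq :: "real \<Rightarrow> real" where
  "neg_sq u = (if u < 0 then u\<^sup>2 else 0)"

section \<open>Cubic Young inequality and bounds for the correction term\<close>

lemma young_cubic:
  fixes x r :: real
  assumes "0 \<le> x" "0 \<le> r"
  shows "3 * x * r\<^sup>2 \<le> x ^ 3 + 2 * r ^ 3"
proof -
  \<comment> \<open>This product is exactly right minus left; equality holds at
    \<open>x = r\<close>, so rescaling \<open>r\<close> tunes the constants.\<close>
  have "0 \<le> (x - r)\<^sup>2 * (x + 2 * r)" using assms by simp
  then show ?thesis by (simp add: power2_eq_square power3_eq_cube algebra_simps)
qed

text \<open>The expression is \<open>(p + e)\<^sup>2 - p\<^sup>2\<close>, increasing in
  \<open>e\<close> while \<open>p\<close> and \<open>e\<close> are nonnegative; an excess may thus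
  be replaced by any majorant.\<close>

lemma quadratic_mono_bound:
  fixes e E p :: real
  assumes "0 \<le> e" "e \<le> E" "0 \<le> p"
  shows "e * (2 * p + e) \<le> E * (2 * p + E)"
  using assms by (intro mult_mono) auto

text \<open>Controls pairs for which the correction exceeds the excess
  \<open>(1 - s)\<^sup>2 / 2\<close>; \<open>x\<close> stands for the modulus of the inner product.
  When both deviations are negative, each takes half of the allowance 9 for the inner product. When
  only one is negative it takes all of it, and then \<open>39/10\<close> leaves \<open>6/10\<close>
  of \<open>9/2\<close> for the mean-zero cross term.\<close>

lemma corr_young:
  fixes a x :: real
  assumes "0 \<le> a" "a \<le> 1/2" "0 \<le> x"
  defines "\<Psi> \<equiv> a\<^sup>2 * (4 - 6 * a)"
  shows corr_young_half: "\<Psi>\<^sup>2 + 2 * x * \<Psi> \<le> 9/2 * a ^ 3 + 9/2 * cubic_min x"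
    and corr_young_full: "\<Psi>\<^sup>2 + 2 * x * \<Psi> \<le> 39/10 * a ^ 3 + 9 * cubic_min x"
proof -
  have P0: "0 \<le> \<Psi>" using assms by simp
  have a2: "a\<^sup>2 \<le> a / 2"
    using mult_left_mono[of a "1/2" a] assms by (simp add: power2_eq_square)
  then have a3: "a ^ 3 \<le> a / 4"
    using mult_left_mono[of "a\<^sup>2" "a/2" a] assms(1) by (simp add: power2_eq_square power3_eq_cube)
  have "a\<^sup>2 \<le> (1/2)\<^sup>2" using assms by (intro power_mono) auto
  moreover have "\<Psi> \<le> a\<^sup>2 * 4" unfolding \<Psi>_def using assms by (intro mult_left_mono) auto
  ultimately have P1: "\<Psi> \<le> 1" by (simp add: power2_eq_square)
  have large: "\<Psi>\<^sup>2 + 2 * x * \<Psi> \<le> 3 * cubic_min x" if "1 \<le> x"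
  proof -
    have "\<Psi>\<^sup>2 \<le> 1" using P0 P1 by (simp add: power_le_one)
    moreover have "1 \<le> x\<^sup>2" "x \<le> x\<^sup>2" using that by (simp_all add: self_le_power)
    moreover have "x * \<Psi> \<le> x * 1" using that P1 by (intro mult_left_mono) auto
    ultimately have "\<Psi>\<^sup>2 + 2 * x * \<Psi> \<le> 3 * x\<^sup>2" by linarith
    then show ?thesis using that by (simp add: cubic_min_large)
  qed
  \<comment> \<open>Young's inequality with \<open>r = \<mu> a\<close>; below, \<open>\<mu>\<close> is a linear majorant of the optimal
    \<open>sqrt (2 (4 - 6 a) / (3 K))\<close>.\<close>
  have gen: "\<Psi>\<^sup>2 + 2 * x * \<Psi> \<le> C * a ^ 3 + K * x ^ 3"
    if m: "0 \<le> \<mu>" and K: "0 \<le> K" and h1: "2 * (4 - 6 * a) \<le> 3 * K * \<mu>\<^sup>2"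
      and h2: "2 * K * \<mu> ^ 3 + a * (4 - 6 * a)\<^sup>2 \<le> C" for \<mu> C K
  proof -
    have "K * (3 * x * (\<mu> * a)\<^sup>2) \<le> K * (x ^ 3 + 2 * (\<mu> * a) ^ 3)"
      using assms m K by (intro mult_left_mono young_cubic) auto
    moreover have "x * a\<^sup>2 * (2 * (4 - 6 * a)) \<le> x * a\<^sup>2 * (3 * K * \<mu>\<^sup>2)"
      using h1 assms by (intro mult_left_mono) auto
    moreover have "a ^ 3 * (2 * K * \<mu> ^ 3 + a * (4 - 6 * a)\<^sup>2) \<le> a ^ 3 * C"
      using h2 assms by (intro mult_left_mono) auto
    ultimately show ?thesis
      unfolding \<Psi>_def by (simp add: power2_eq_square power3_eq_cube algebra_simps)
  qed
  show "\<Psi>\<^sup>2 + 2 * x * \<Psi> \<le> 9/2 * a ^ 3 + 9/2 * cubic_min x"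
  proof (cases "x \<le> 1")
    case True
    have "\<Psi>\<^sup>2 + 2 * x * \<Psi> \<le> 9/2 * a ^ 3 + 9/2 * x ^ 3"
    proof (rule gen[where \<mu> = "771/1000 - 577/1000 * a"])
      show "2 * (4 - 6 * a) \<le> 3 * (9/2) * (771/1000 - 577/1000 * a)\<^sup>2"
      proof -
        have "0 \<le> (a - 1/1000)\<^sup>2" by simp
        then show ?thesis using assms by (simp add: power2_eq_square algebra_simps)
      qed
      show "2 * (9/2) * (771/1000 - 577/1000 * a) ^ 3 + a * (4 - 6 * a)\<^sup>2 \<le> 9/2"
      proof -
        \<comment> \<open>The slack in the goal is a cubic in \<open>a\<close> whose minimum on the
          interval lies near \<open>92/1000\<close>; the square is centred there.\<close>
        have "0 \<le> (a - 92/1000)\<^sup>2 * (34764/1000 - 3427/100 * a)"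
          using assms by (intro mult_nonneg_nonneg) auto
        moreover have "0 \<le> a\<^sup>2" "0 \<le> a ^ 3" "a\<^sup>2 \<le> a / 2" "a ^ 3 \<le> a / 4"
          using assms a2 a3 by auto
        ultimately show ?thesis using assms by (simp add: power2_eq_square power3_eq_cube algebra_simps)
      qed
    qed (use assms in auto)
    then show ?thesis using True assms by (simp add: cubic_min_small)
  next
    case False
    then have "\<Psi>\<^sup>2 + 2 * x * \<Psi> \<le> 3 * cubic_min x" by (intro large) simp
    then show ?thesis using cubic_min_nonneg[of x] zero_le_power[OF assms(1), of 3] by linarith
  qed
  show "\<Psi>\<^sup>2 + 2 * x * \<Psi> \<le> 39/10 * a ^ 3 + 9 * cubic_min x"
  proof (cases "x \<le> 1")
    case True
    have "\<Psi>\<^sup>2 + 2 * x * \<Psi> \<le> 39/10 * a ^ 3 + 9 * x ^ 3"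
    proof (rule gen[where \<mu> = "5455/10000 - 408/1000 * a"])
      show "2 * (4 - 6 * a) \<le> 3 * 9 * (5455/10000 - 408/1000 * a)\<^sup>2"
      proof -
        have "0 \<le> (a - 1/1000)\<^sup>2" by simp
        then show ?thesis using assms by (simp add: power2_eq_square algebra_simps)
      qed
      show "2 * 9 * (5455/10000 - 408/1000 * a) ^ 3 + a * (4 - 6 * a)\<^sup>2 \<le> 39/10"
      proof -
        \<comment> \<open>The same device: this slack is smallest near
          \<open>a = 13/100\<close>.\<close>
        have "0 \<le> (a - 13/100)\<^sup>2 * (341/10 - 347/10 * a)"
          using assms by (intro mult_nonneg_nonneg) auto
        moreover have "0 \<le> a\<^sup>2" "0 \<le> a ^ 3" "a\<^sup>2 \<le> a / 2" "a ^ 3 \<le> a / 4"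
          using assms a2 a3 by auto
        moreover have "(a - 13/100)\<^sup>2 * (341/10 - 347/10 * a)
            = 341/10 * a\<^sup>2 - 8866/1000 * a + 57629/100000 - 347/10 * a ^ 3 + 9022/1000 * a\<^sup>2 - 58643/100000 * a"
          by (simp add: power2_eq_square power3_eq_cube algebra_simps)
        moreover have "2 * 9 * (5455/10000 - 408/1000 * a) ^ 3
            = 11687369139/4000000000 - 1639016937/250000000 * a + 76617657/15625000 * a\<^sup>2
              - 2387718/1953125 * a ^ 3"
          by (simp add: power2_eq_square power3_eq_cube field_simps)
        moreover have "a * (4 - 6 * a)\<^sup>2 = 16 * a - 48 * a\<^sup>2 + 36 * a ^ 3"
          by (simp add: power2_eq_square power3_eq_cube algebra_simps)
        ultimately show ?thesis using assms by linarith
      qed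
    qed (use assms in auto)
    then show ?thesis using True assms by (simp add: cubic_min_small)
  next
    case False
    then have "\<Psi>\<^sup>2 + 2 * x * \<Psi> \<le> 3 * cubic_min x" by (intro large) simp
    then show ?thesis using cubic_min_nonneg[of x] zero_le_power[OF assms(1), of 3] by linarith
  qed
qed

section \<open>Close pairs with two equal negative deviations\<close>

text \<open>Proved by an explicit certificate; the slack is smallest near \<open>x = 27/100\<close>,
  where the last square is centred. The coefficient 13 is \<open>9/2 + 9/2 + 4\<close>: the two
  cubic allowances and the mean-zero contribution \<open>2 * a * b * (a + b)\<close>, all on the
  diagonal \<open>a = b\<close>.\<close>

lemma sextic_bound:
  fixes x :: real
  assumes "0 \<le> x" "x \<le> 1"
  defines "\<rho> \<equiv> 1 - 4 * x\<^sup>2 + 3 * x ^ 3"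
  shows "\<rho> * (2 * (1 - x) + \<rho>) \<le> (9 * (1 - x) ^ 3 + 13 * x ^ 3) / 2"
proof -
  have "0 \<le> 9 * x ^ 5 * (1 - x) + 15 * x ^ 3 * (x - 2/5)\<^sup>2 + 2 * x\<^sup>2 * (x - 1/2)\<^sup>2
     + (x - 27/100)\<^sup>2 * (19064/1000 - 184/10 * x) + 136/1000 * x"
    using assms(1,2) by (intro add_nonneg_nonneg mult_nonneg_nonneg) auto
  then show ?thesis unfolding \<rho>_def using assms(1,2) by (simp add: eval_nat_numeral algebra_simps)
qed

text \<open>The critical case: \<open>t = 1 - s\<close> and \<open>u = v = - c\<close>. In terms of \<open>\<theta> = c / (p + c)\<close> it is extremal at
  \<open>t = 1\<close>, where it becomes \<open>sextic_bound\<close>.\<close>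

lemma close_pair_bound:
  fixes t c :: real
  assumes "0 \<le> t" "t \<le> 1" "0 \<le> c"
  defines "p \<equiv> t - t\<^sup>2 / 2 - c" and "E \<equiv> t\<^sup>2 / 2 - 8 * c\<^sup>2 + 12 * c ^ 3"
  assumes "0 \<le> p" "0 \<le> E"
  shows "E * (2 * p + E) \<le> 9 * p ^ 3 + 13 * c ^ 3"
proof (cases "t = 0")
  case True
  then have "c = 0" using assms by auto
  then show ?thesis using True by (simp add: p_def E_def)
next
  case False
  then have t: "0 < t" using assms by simp
  define r where "r = t - t\<^sup>2 / 2"
  have tt: "t\<^sup>2 \<le> t" using assms by (simp add: power2_eq_square mult_left_le)
  have r: "t\<^sup>2 / 2 \<le> r" "t / 2 \<le> r" using tt by (auto simp: r_def)
  have "0 \<le> (1 - t)\<^sup>2" by simp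
  then have r1: "r \<le> 1/2" by (simp add: r_def power2_eq_square algebra_simps)
  have r0: "0 < r" using t r by linarith
  define \<theta> where "\<theta> = c / r"
  have c: "c = \<theta> * r" using r0 by (simp add: \<theta>_def)
  have th: "0 \<le> \<theta>" "\<theta> \<le> 1" using assms r0 by (auto simp: \<theta>_def r_def)
  define \<rho> where "\<rho> = 1 - 4 * \<theta>\<^sup>2 + 3 * \<theta> ^ 3"
  have "p = r - c" by (simp add: p_def r_def)
  then have p: "p = (1 - \<theta>) * r" using c by (simp add: algebra_simps)
  \<comment> \<open>This bound, \<open>t\<^sup>2 / 2 \<le> r\<close> and the bound on
    \<open>E\<close> below are all equalities at \<open>t = 1\<close>, so nothing is lost in the
    extremal case.\<close>
  have t2: "t\<^sup>2 / 2 \<le> 2 * r\<^sup>2" using power_mono[OF r(2), of 2] t by (simp add: power2_eq_square)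
  have E: "E \<le> t\<^sup>2 / 2 * \<rho>"
  proof -
    have "\<theta> * r * r\<^sup>2 \<le> \<theta> * (1/2) * r\<^sup>2" using th r1 by (intro mult_right_mono mult_left_mono) auto
    then have "\<theta> * r ^ 3 \<le> \<theta> / 2 * r\<^sup>2" by (simp add: power2_eq_square power3_eq_cube)
    moreover have "t\<^sup>2 / 2 * (4 - 3 * \<theta>) \<le> 2 * r\<^sup>2 * (4 - 3 * \<theta>)"
      using th t2 by (intro mult_right_mono) auto
    ultimately have "t\<^sup>2 / 2 * (4 - 3 * \<theta>) \<le> 8 * r\<^sup>2 - 12 * (\<theta> * r ^ 3)" by (simp add: algebra_simps)
    then have "\<theta>\<^sup>2 * (t\<^sup>2 / 2 * (4 - 3 * \<theta>)) \<le> \<theta>\<^sup>2 * (8 * r\<^sup>2 - 12 * (\<theta> * r ^ 3))"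
      by (intro mult_left_mono) auto
    then show ?thesis unfolding E_def c \<rho>_def
      by (simp add: power2_eq_square power3_eq_cube algebra_simps)
  qed
  have rho0: "0 \<le> \<rho>" using order_trans[OF \<open>0 \<le> E\<close> E] t by (simp add: zero_le_mult_iff)
  have "E * (2 * p + E) \<le> t\<^sup>2 / 2 * \<rho> * (2 * p + t\<^sup>2 / 2 * \<rho>)"
    by (rule quadratic_mono_bound) (use assms E in auto)
  also have "\<dots> \<le> t\<^sup>2 / 2 * \<rho> * (2 * p + r * \<rho>)"
    using rho0 r by (intro mult_left_mono add_left_mono mult_right_mono) auto
  also have "\<dots> = t\<^sup>2 / 2 * r * (\<rho> * (2 * (1 - \<theta>) + \<rho>))" by (simp add: p algebra_simps)
  also have "\<dots> \<le> t\<^sup>2 / 2 * r * ((9 * (1 - \<theta>) ^ 3 + 13 * \<theta> ^ 3) / 2)"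
    unfolding \<rho>_def using r0 sextic_bound[OF th] by (intro mult_left_mono) auto
  also have "\<dots> \<le> 2 * r\<^sup>2 * r * ((9 * (1 - \<theta>) ^ 3 + 13 * \<theta> ^ 3) / 2)"
    using t2 r0 th by (intro mult_right_mono) auto
  also have "\<dots> = 9 * p ^ 3 + 13 * c ^ 3"
    by (simp add: p c power2_eq_square power3_eq_cube field_simps)
  finally show ?thesis .
qed

section \<open>Far pairs, obtuse pairs and cross terms\<close>

text \<open>With \<open>f = s - 1\<close>, the law of cosines reads
  \<open>f\<^sup>2 + 2 * f = u + v - 2 * p\<close>, so \<open>f\<close> is controlled by
  \<open>c\<close> and \<open>- p\<close>. The parameter \<open>j\<close> measures the mean
  deviation against \<open>M\<close>: 1 when both deviations may be positive, while
  \<open>1/2\<close> suffices when at most one is.\<close>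

lemma far_pair_bound:
  fixes u v p s c e j M :: real
  assumes "1 \<le> s" and ss: "s\<^sup>2 = 1 + u + v - 2 * p" and uv: "u + v \<le> 2 * c" and "0 \<le> c"
    and e: "0 \<le> e" "e \<le> (1 - s)\<^sup>2 / 2"
    and j: "0 \<le> j" "j \<le> 1" and cM: "c \<le> j * M" and pM: "- p \<le> M" and "0 \<le> M"
  shows "e * (2 * p + e) \<le> (1 + j)\<^sup>2 * cubic_min M"
proof -
  define f where "f = s - 1"
  define E where "E = f\<^sup>2 / 2"
  have f0: "0 \<le> f" using assms by (simp add: f_def)
  have ff: "f\<^sup>2 + 2 * f = u + v - 2 * p" using ss by (simp add: f_def power2_eq_square algebra_simps)
  have eE: "e \<le> E" using e by (simp add: E_def f_def power2_commute)
  have j4: "(1 + j) ^ 4 \<le> 4 * (1 + j)\<^sup>2"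
  proof -
    have "(1 + j)\<^sup>2 \<le> 2\<^sup>2" using j by (intro power_mono) auto
    then have "(1 + j)\<^sup>2 * (1 + j)\<^sup>2 \<le> (1 + j)\<^sup>2 * 4" by (intro mult_left_mono) auto
    then show ?thesis by (simp add: power2_eq_square eval_nat_numeral algebra_simps)
  qed
  show ?thesis
  proof (cases "0 \<le> p")
    case True
    have "0 \<le> f\<^sup>2" by simp
    then have "f \<le> c" "f\<^sup>2 \<le> 2 * c" using ff uv True f0 by linarith+
    have "e * (2 * p + e) \<le> E * (2 * p + E)" using e eE True by (intro quadratic_mono_bound)
    also have "\<dots> = f\<^sup>2 * (p + f\<^sup>2 / 4)" by (simp add: E_def field_simps)
    \<comment> \<open>The identity \<open>ff\<close> gives
      \<open>p \<le> c - f - f\<^sup>2 / 2\<close>, which leaves room for the added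
      \<open>f\<^sup>2 / 4\<close>.\<close>
    also have "\<dots> \<le> f\<^sup>2 * c"
      using ff uv f0 \<open>0 \<le> f\<^sup>2\<close> by (intro mult_left_mono) linarith+
    finally have G: "e * (2 * p + e) \<le> f\<^sup>2 * c" .
    have c0: "f\<^sup>2 * c \<le> c\<^sup>2 * c" using \<open>f \<le> c\<close> f0 \<open>0 \<le> c\<close> by (intro mult_right_mono power_mono) auto
    have c1: "f\<^sup>2 * c \<le> 2 * c * c" using \<open>f\<^sup>2 \<le> 2 * c\<close> \<open>0 \<le> c\<close> by (intro mult_right_mono) auto
    have j2: "j ^ 3 \<le> (1 + j)\<^sup>2" "2 * j\<^sup>2 \<le> (1 + j)\<^sup>2"
    proof -
      have "j ^ 3 \<le> 1" "j\<^sup>2 \<le> 1" "0 \<le> j * j" using j by (auto intro: power_le_one)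
      then show "j ^ 3 \<le> (1 + j)\<^sup>2" "2 * j\<^sup>2 \<le> (1 + j)\<^sup>2"
        using j unfolding power2_eq_square distrib_left distrib_right by linarith+
    qed
    show ?thesis
    proof (rule le_cubic_minI)
      have "c ^ 3 \<le> (j * M) ^ 3" using cM \<open>0 \<le> c\<close> by (intro power_mono) auto
      also have "\<dots> \<le> (1 + j)\<^sup>2 * M ^ 3" unfolding power_mult_distrib
        using j2 \<open>0 \<le> M\<close> by (intro mult_right_mono) auto
      finally show "e * (2 * p + e) \<le> (1 + j)\<^sup>2 * M ^ 3"
        using G c0 by (simp add: power2_eq_square power3_eq_cube)
      have "2 * c\<^sup>2 \<le> 2 * (j * M)\<^sup>2" using cM \<open>0 \<le> c\<close> by (intro mult_left_mono power_mono) auto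
      also have "\<dots> = 2 * j\<^sup>2 * M\<^sup>2" by (simp add: power_mult_distrib)
      also have "\<dots> \<le> (1 + j)\<^sup>2 * M\<^sup>2" 
        using j2 \<open>0 \<le> M\<close> by (intro mult_right_mono) auto
      finally show "e * (2 * p + e) \<le> (1 + j)\<^sup>2 * M\<^sup>2"
        using G c1 by (simp add: power2_eq_square)
    qed (use assms in auto)
  next
    case False
    define z where "z = c - p"
    have z0: "0 \<le> z" using False assms by (simp add: z_def)
    have "f\<^sup>2 + 2 * f \<le> 2 * z" "0 \<le> f\<^sup>2" using ff uv by (auto simp: z_def)
    then have fz: "f \<le> z" "f\<^sup>2 \<le> 2 * z" using f0 by linarith+
    have zM: "z \<le> (1 + j) * M" using cM pM by (simp add: z_def algebra_simps)
    \<comment> \<open>For negative \<open>p\<close> the mixed term helps and is dropped, leaving a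
      fourth power of \<open>f\<close>.\<close>
    have "e * (2 * p + e) \<le> e * e" using e False by (intro mult_left_mono) auto
    also have "\<dots> \<le> E * E" using e eE by (intro mult_mono) auto
    finally have G: "e * (2 * p + e) \<le> E * E" .
    show ?thesis
    proof (rule le_cubic_minI)
      assume "M \<le> 1"
      have "E * E = f ^ 4 / 4" by (simp add: E_def eval_nat_numeral)
      also have "\<dots> \<le> ((1 + j) * M) ^ 4 / 4" using fz zM f0 by (intro divide_right_mono power_mono) auto
      also have "\<dots> = (1 + j) ^ 4 * M ^ 3 * M / 4" by (simp add: power_mult_distrib eval_nat_numeral)
      also have "\<dots> \<le> (4 * (1 + j)\<^sup>2) * M ^ 3 * 1 / 4"
        using j4 \<open>M \<le> 1\<close> \<open>0 \<le> M\<close> by (intro divide_right_mono mult_mono) auto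
      finally show "e * (2 * p + e) \<le> (1 + j)\<^sup>2 * M ^ 3" using G by simp
    next
      have "E * E \<le> z * z" using fz z0 by (intro mult_mono) (auto simp: E_def)
      also have "\<dots> \<le> ((1 + j) * M) * ((1 + j) * M)" using zM z0 j assms by (intro mult_mono) auto
      finally show "e * (2 * p + e) \<le> (1 + j)\<^sup>2 * M\<^sup>2" using G by (simp add: power2_eq_square ac_simps)
    qed (use assms in auto)
  qed
qed

text \<open>With \<open>t = 1 - s\<close> in the unit interval,
  \<open>t \<le> t * (2 - t) = 2 * p - u - v \<le> n\<close>, since \<open>p\<close> is nonpositive:
  only negative deviations can bring the points close. Then \<open>(t\<^sup>2 / 2)\<^sup>2\<close>
  is at most a quarter of \<open>n ^ 3\<close>.\<close>

lemma near_obtuse_pair_bound: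
  fixes u v p s e n :: real
  assumes "0 \<le> s" "s \<le> 1" and ss: "s\<^sup>2 = 1 + u + v - 2 * p" and "p \<le> 0"
    and e: "0 \<le> e" "e \<le> (1 - s)\<^sup>2 / 2" and n: "- n \<le> u + v"
  shows "e * (2 * p + e) \<le> n ^ 3 / 4"
proof -
  define t where "t = 1 - s"
  have t: "0 \<le> t" "t \<le> 1" using assms by (auto simp: t_def)
  have "t * 1 \<le> t * (2 - t)" using t by (intro mult_left_mono) auto
  also have "t * (2 - t) = 2 * p - u - v" using ss by (simp add: t_def power2_eq_square algebra_simps)
  finally have tn: "t \<le> n" using n assms by linarith
  have "e * (2 * p + e) \<le> e * e" using e assms by (intro mult_left_mono) auto
  also have "\<dots> \<le> (t\<^sup>2 / 2) * (t\<^sup>2 / 2)" using e by (intro mult_mono) (auto simp: t_def)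
  also have "\<dots> = t ^ 3 * t / 4" by (simp add: eval_nat_numeral)
  also have "\<dots> \<le> t ^ 3 * 1 / 4" using t by (intro divide_right_mono mult_left_mono) auto
  also have "\<dots> \<le> n ^ 3 / 4" using t tn by (simp add: power_mono)
  finally show ?thesis .
qed

text \<open>Covers overcorrection: \<open>e\<close> is nonpositive but no lower than
  \<open>- \<Psi>\<close>, and the right-hand side is the quantity estimated in
  \<open>corr_young\<close>.\<close>

lemma negative_quadratic_bound:
  fixes e E \<Psi> p :: real
  assumes "e = E - \<Psi>" "0 \<le> E" "e \<le> 0"
  shows "e * (2 * p + e) \<le> \<Psi>\<^sup>2 + 2 * \<bar>p\<bar> * \<Psi>"
proof -
  have d: "0 \<le> - e" "- e \<le> \<Psi>" using assms by auto
  have "e * (2 * p + e) = (- e) * (- e) + 2 * ((- e) * (- p))" by (simp add: algebra_simps)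
  also have "\<dots> \<le> \<Psi> * \<Psi> + 2 * (\<Psi> * \<bar>p\<bar>)"
  proof -
    have "(- e) * (- e) \<le> \<Psi> * \<Psi>" using d by (intro mult_mono) auto
    moreover have "(- e) * (- p) \<le> (- e) * \<bar>p\<bar>" using d by (intro mult_left_mono) auto
    moreover have "(- e) * \<bar>p\<bar> \<le> \<Psi> * \<bar>p\<bar>" using d by (intro mult_right_mono) auto
    ultimately show ?thesis by linarith
  qed
  finally show ?thesis by (simp add: power2_eq_square algebra_simps)
qed

text \<open>Young's inequality with \<open>r = 2/5 * a\<close>. The coefficient \<open>6/10\<close>
  is what \<open>39/10\<close> leaves of \<open>9/2\<close>.\<close>

lemma cross_term_bound_sharp:
  fixes a v :: real
  assumes "0 \<le> a" "a \<le> 1/2" "0 \<le> v"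
  shows "2 * a\<^sup>2 * v \<le> 6/10 * a ^ 3 + 9/2 * cubic_min v"
proof (cases "v \<le> 1")
  case True
  have "3 * v * (2/5 * a)\<^sup>2 \<le> v ^ 3 + 2 * (2/5 * a) ^ 3" using assms by (intro young_cubic) auto
  moreover have "0 \<le> a\<^sup>2 * v" "0 \<le> a ^ 3" using assms by auto
  ultimately have "2 * a\<^sup>2 * v \<le> 6/10 * a ^ 3 + 9/2 * v ^ 3"
    by (simp add: power2_eq_square power3_eq_cube algebra_simps)
  then show ?thesis using assms True by (simp add: cubic_min_small)
next
  case False
  have "a\<^sup>2 \<le> (1/2)\<^sup>2" using assms by (intro power_mono) auto
  then have "2 * a\<^sup>2 * v \<le> 2 * (1/2)\<^sup>2 * v" using assms by (intro mult_mono) auto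
  moreover have "v \<le> v\<^sup>2" using False by (simp add: self_le_power)
  moreover have "0 \<le> a ^ 3" using assms by simp
  moreover have "2 * (1/2)\<^sup>2 * v = v / 2" by (simp add: power2_eq_square)
  ultimately have "2 * a\<^sup>2 * v \<le> 6/10 * a ^ 3 + 9/2 * v\<^sup>2" using False by linarith
  then show ?thesis using False by (simp add: cubic_min_large)
qed

text \<open>A balanced variant for the far and the obtuse case, where the main term leaves enough of
  both \<open>9/2\<close> allowances to pay 2.\<close>

lemma cross_term_bound:
  fixes a v :: real
  assumes "0 \<le> a" "a \<le> 1/2" "0 \<le> v"
  shows "2 * a\<^sup>2 * v \<le> 2 * a ^ 3 + 2 * cubic_min v"
proof (cases "v \<le> 1")
  case True
  have "3 * v * a\<^sup>2 \<le> v ^ 3 + 2 * a ^ 3" using assms by (intro young_cubic) auto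
  moreover have "0 \<le> a\<^sup>2 * v" "0 \<le> v ^ 3" using assms by auto
  moreover have "3 * v * a\<^sup>2 = 3 * (a\<^sup>2 * v)" "2 * a\<^sup>2 * v = 2 * (a\<^sup>2 * v)" by simp_all
  ultimately have "2 * a\<^sup>2 * v \<le> 2 * a ^ 3 + 2 * v ^ 3" by linarith
  then show ?thesis using assms True by (simp add: cubic_min_small)
next
  case False
  have "a\<^sup>2 \<le> (1/2)\<^sup>2" using assms by (intro power_mono) auto
  then have "2 * a\<^sup>2 * v \<le> 2 * (1/2)\<^sup>2 * v" using assms by (intro mult_mono) auto
  moreover have "v \<le> v\<^sup>2" using False by (simp add: self_le_power)
  moreover have "0 \<le> a ^ 3" using assms by simp
  moreover have "2 * (1/2)\<^sup>2 * v = v / 2" by (simp add: power2_eq_square)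
  ultimately have "2 * a\<^sup>2 * v \<le> 2 * a ^ 3 + 2 * v\<^sup>2" using False by linarith
  then show ?thesis using False by (simp add: cubic_min_large)
qed

section \<open>The pointwise bounds, by signs of the deviations\<close>

text \<open>No correction acts here. Far pairs cost \<open>4 * cubic_min M\<close> for the dominant
  \<open>M\<close>; for close pairs \<open>t \<le> 2 * p\<close>, so the inner product alone pays,
  with constant 8.\<close>

lemma pointwise_nonneg:
  fixes u v p s :: real
  assumes "0 \<le> s" and ss: "s\<^sup>2 = 1 + u + v - 2 * p" and uv: "0 \<le> u" "0 \<le> v"
  defines "E \<equiv> (1 - s)\<^sup>2 / 2"
  shows "E * (2 * p + E) \<le> 9/2 * cubic_min u + 9/2 * cubic_min v + 9 * cubic_min p"
proof (cases "1 \<le> s")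
  case True
  have "\<exists>M\<in>{u, v, - p}. u \<le> M \<and> v \<le> M \<and> - p \<le> M"
    by (cases "u \<le> v"; cases "v \<le> - p"; cases "u \<le> - p") auto
  then obtain M where M: "M \<in> {u, v, - p}" "u \<le> M" "v \<le> M" "- p \<le> M" by blast
  have "E * (2 * p + E) \<le> (1 + 1)\<^sup>2 * cubic_min M"
    by (rule far_pair_bound[OF True ss, where c = "(u + v) / 2"]) (use M uv in \<open>auto simp: E_def\<close>)
  then have "E * (2 * p + E) \<le> 4 * cubic_min M" by simp
  moreover have "cubic_min M \<le> cubic_min u + cubic_min v + cubic_min p"
    using M(1) by (auto simp: add_increasing add_increasing2)
  moreover have "0 \<le> cubic_min u" "0 \<le> cubic_min v" "0 \<le> cubic_min p" by auto
  ultimately show ?thesis by linarith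
next
  case False
  define t where "t = 1 - s"
  have t: "0 \<le> t" "t \<le> 1" using False assms by (auto simp: t_def)
  have "2 * t - t\<^sup>2 = 1 - s\<^sup>2" by (simp add: t_def power2_eq_square algebra_simps)
  then have tp: "2 * t - t\<^sup>2 \<le> 2 * p" using ss uv by simp
  have tt: "t\<^sup>2 \<le> t" using t by (simp add: power2_eq_square mult_left_le)
  have tp': "t \<le> 2 * p" using tp tt by simp
  have "E * (2 * p + E) = t\<^sup>2 * (p + t\<^sup>2 / 4)" by (simp add: E_def t_def field_simps)
  also have "\<dots> \<le> t\<^sup>2 * (2 * p)" using tp' tt t by (intro mult_left_mono) auto
  finally have G: "E * (2 * p + E) \<le> t\<^sup>2 * (2 * p)" .
  have "E * (2 * p + E) \<le> 8 * cubic_min p"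
  proof (rule le_cubic_minI)
    have "t\<^sup>2 * (2 * p) \<le> (2 * p)\<^sup>2 * (2 * p)" using t tp' by (intro mult_right_mono power_mono) auto
    also have "\<dots> = 8 * p ^ 3" by (simp add: power2_eq_square power3_eq_cube)
    finally show "E * (2 * p + E) \<le> 8 * p ^ 3" using G by linarith
    assume "1 \<le> p"
    have "t\<^sup>2 * (2 * p) \<le> 1 * (2 * p)" using t tp' by (intro mult_right_mono) (auto simp: power_le_one)
    moreover have "p \<le> p\<^sup>2" using \<open>1 \<le> p\<close> by (simp add: self_le_power)
    ultimately show "E * (2 * p + E) \<le> 8 * p\<^sup>2" using G \<open>1 \<le> p\<close> by linarith
  qed (use t tp' in auto)
  moreover have "0 \<le> cubic_min u" "0 \<le> cubic_min v" "0 \<le> cubic_min p" by auto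
  ultimately show ?thesis by linarith
qed

text \<open>The boundary case in which the nonnegative deviation is zero. Up to
  \<open>a = 4/9\<close> the correction \<open>a\<^sup>2 * (4 - 6 * a)\<close> dominates that of two
  deviations of size \<open>a / 2\<close>, so \<open>close_pair_bound\<close> applies with
  \<open>c = a / 2\<close>. Beyond it, \<open>p \<le> 5/18\<close> and \<open>e \<le> 1/4\<close>
  make crude estimates enough.\<close>

lemma close_mixed_pair_bound_aux:
  fixes t a e p :: real
  assumes t: "0 \<le> t" "t \<le> 1" and a: "0 \<le> a" "a \<le> 1/2" and p: "0 \<le> p" "p = t - t\<^sup>2 / 2 - a / 2"
    and e: "0 \<le> e" "e \<le> t\<^sup>2 / 2 - 4 * a\<^sup>2 + 6 * a ^ 3"
  shows "e * (2 * p + e) \<le> 9 * p ^ 3 + 39/10 * a ^ 3"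
proof (cases "a \<le> 4/9")
  case True
  define E where "E = t\<^sup>2 / 2 - 8 * (a / 2)\<^sup>2 + 12 * (a / 2) ^ 3"
  have "0 \<le> a\<^sup>2 * (2 - 9/2 * a)" using True by simp
  then have eE: "e \<le> E" using e(2) by (simp add: E_def power2_eq_square power3_eq_cube field_simps)
  have "e * (2 * p + e) \<le> E * (2 * p + E)" using e eE p by (intro quadratic_mono_bound) auto
  also have "\<dots> \<le> 9 * p ^ 3 + 13 * (a / 2) ^ 3"
    unfolding p(2) E_def by (rule close_pair_bound) (use t a p e eE in \<open>auto simp: E_def\<close>)
  also have "\<dots> \<le> 9 * p ^ 3 + 39/10 * a ^ 3" using a by (simp add: power3_eq_cube)
  finally show ?thesis .
next
  case False
  have "0 \<le> (1 - t)\<^sup>2" by simp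
  then have "p \<le> 1/2 - a/2" by (simp add: p power2_eq_square algebra_simps)
  then have p': "p \<le> 5/18" using False by simp
  have "a\<^sup>2 * (4 - 6 * a) \<ge> 1/4"
  proof -
    \<comment> \<open>Equality holds at \<open>a = 1/2\<close>, hence the factor
      \<open>1/2 - a\<close>.\<close>
    have "0 \<le> (1/2 - a) * (6 * a\<^sup>2 - a - 1/2)"
    proof (intro mult_nonneg_nonneg)
      have "(4/9) * (4/9) \<le> a * a" using False by (intro mult_mono) auto
      then show "0 \<le> 6 * a\<^sup>2 - a - 1/2" using a unfolding power2_eq_square by linarith
    qed (use a in auto)
    then show ?thesis by (simp add: power2_eq_square algebra_simps)
  qed
  then have "e \<le> t\<^sup>2 / 2 - 1/4" using e(2) by (simp add: power2_eq_square power3_eq_cube algebra_simps)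
  moreover have "t\<^sup>2 \<le> 1" using t by (simp add: power_le_one)
  ultimately have "e \<le> 1/4" by simp
  then have "e * (2 * p + e) \<le> 1/4 * (2 * (5/18) + 1/4)" using e p p' by (intro mult_mono) auto
  also have "\<dots> \<le> 39/10 * (4/9) ^ 3" by (simp add: power3_eq_cube)
  also have "\<dots> \<le> 39/10 * a ^ 3" using False by (intro mult_left_mono power_mono) auto
  finally show ?thesis using zero_le_power[OF p(1), of 3] by linarith
qed

text \<open>For given \<open>p\<close> and \<open>a\<close>, a positive deviation only makes
  \<open>t\<close> smaller, so the bound is pushed back to the boundary case.\<close>

lemma close_mixed_pair_bound:
  fixes t a e p :: real
  assumes t: "0 \<le> t" "t \<le> 1" and a: "0 \<le> a" "a \<le> 1/2" and p: "0 \<le> p" "t - t\<^sup>2 / 2 \<le> p + a / 2"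
    and e: "0 \<le> e" "e \<le> t\<^sup>2 / 2 - 4 * a\<^sup>2 + 6 * a ^ 3"
  shows "e * (2 * p + e) \<le> 9 * cubic_min p + 39/10 * a ^ 3"
proof -
  have tt: "t\<^sup>2 \<le> 1" using t by (simp add: power_le_one)
  have "0 \<le> a\<^sup>2 * (4 - 6 * a)" using a by simp
  then have ps: "0 \<le> 4 * a\<^sup>2 - 6 * a ^ 3" by (simp add: power2_eq_square power3_eq_cube algebra_simps)
  then have e2: "e \<le> 1/2" using e tt by simp
  show ?thesis
  proof (cases "p \<le> 1")
    case True
    have "e * (2 * p + e) \<le> 9 * p ^ 3 + 39/10 * a ^ 3"
    proof (cases "p + a / 2 \<le> 1/2")
      case True
      \<comment> \<open>\<open>1 - s'\<close> is the largest \<open>t\<close> compatible with the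
        constraint and turns it into an equality; the bound on \<open>e\<close> only grows.\<close>
      define s' where "s' = sqrt (1 - 2 * p - a)"
      have s': "0 \<le> s'" "s'\<^sup>2 = 1 - 2 * p - a" using True by (auto simp: s'_def)
      have "(1 - t)\<^sup>2 \<ge> s'\<^sup>2" using p(2) s'(2) by (simp add: power2_eq_square algebra_simps)
      then have "s' \<le> 1 - t" using t by (intro power2_le_imp_le[of s' "1 - t"]) auto
      then have t': "t \<le> 1 - s'" by simp
      then have "t\<^sup>2 \<le> (1 - s')\<^sup>2" using t by (intro power_mono) auto
      moreover have "(1 - s')\<^sup>2 = 2 - 2 * s' - 2 * p - a" using s'(2) by (simp add: power2_diff)
      ultimately show ?thesis
        by (intro close_mixed_pair_bound_aux[where t = "1 - s'"]; use t t' a p e s' in linarith)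
    next
      case False
      \<comment> \<open>Here even \<open>t = 1\<close> is allowed, and \<open>q\<close> is the inner
        product for which the constraint is then tight. Moving from \<open>q\<close> to
        \<open>p\<close> costs at most \<open>p - q\<close>, which the growth of
        \<open>9 * p ^ 3\<close> covers.\<close>
      define q where "q = 1/2 - a/2"
      define E where "E = 1/2 - 4 * a\<^sup>2 + 6 * a ^ 3"
      have eE: "e \<le> E" using e tt by (simp add: E_def)
      have E2: "E \<le> 1/2" using ps by (simp add: E_def)
      have q: "1/4 \<le> q" "q \<le> p" using a False by (auto simp: q_def)
      have "e * (2 * p + e) \<le> E * (2 * p + E)" using e eE p by (intro quadratic_mono_bound) auto
      also have "\<dots> = E * (2 * q + E) + E * (2 * (p - q))" by (simp add: algebra_simps)
      also have "\<dots> \<le> (9 * q ^ 3 + 39/10 * a ^ 3) + 1/2 * (2 * (p - q))"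
        using q eE e E2 a
        by (intro add_mono mult_right_mono close_mixed_pair_bound_aux[where t = 1])
          (auto simp: E_def q_def)
      also have "\<dots> \<le> 9 * p ^ 3 + 39/10 * a ^ 3"
      proof -
        have "1/4 * (1/4) \<le> q * q" "1/4 * (1/4) \<le> p * p" "1/4 * (1/4) \<le> p * q"
          using q by (intro mult_mono; simp)+
        then have "(p - q) * 1 \<le> (p - q) * (9 * (q * q + p * p + p * q))"
          using q by (intro mult_left_mono) auto
        then show ?thesis by (simp add: power3_eq_cube algebra_simps)
      qed
      finally show ?thesis .
    qed
    then show ?thesis using True p by (simp add: cubic_min_small)
  next
    case False
    have "e * (2 * p + e) \<le> 1/2 * (2 * p + 1/2)" using e e2 p by (intro mult_mono) auto
    moreover have "p \<le> p\<^sup>2" using False by (simp add: self_le_power)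
    moreover have "0 \<le> a ^ 3" using a by simp
    moreover have "1/2 * (2 * p + 1/2) = p + 1/4" by simp
    ultimately have "e * (2 * p + e) \<le> 9 * p\<^sup>2 + 39/10 * a ^ 3" using False by linarith
    then show ?thesis using False by (simp add: cubic_min_large)
  qed
qed

text \<open>Here \<open>u = - a\<close>, and the mean-zero terms cost
  \<open>2 * a\<^sup>2 * v\<close>. In the tight cases (\<open>e\<close> nonpositive, or a close
  pair with positive \<open>p\<close>) the allowance for \<open>a\<close> splits as
  \<open>39/10 + 6/10\<close>, and that for \<open>v\<close> goes to the cross term alone.\<close>

lemma pointwise_mixed:
  fixes a v p s :: real
  assumes s0: "0 \<le> s" and ss: "s\<^sup>2 = 1 - a + v - 2 * p" and a: "0 \<le> a" "a \<le> 1/2" and v: "0 \<le> v"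
  defines "E \<equiv> (1 - s)\<^sup>2 / 2" and "\<Psi> \<equiv> a\<^sup>2 * (4 - 6 * a)"
  shows "(E - \<Psi>) * (2 * p + (E - \<Psi>)) + 2 * a\<^sup>2 * v
    \<le> 9/2 * a ^ 3 + 9/2 * cubic_min v + 9 * cubic_min p"
proof -
  define e where "e = E - \<Psi>"
  have E0: "0 \<le> E" by (simp add: E_def)
  have P0: "0 \<le> \<Psi>" using a by (simp add: \<Psi>_def)
  have eE: "e \<le> (1 - s)\<^sup>2 / 2" using P0 by (simp add: e_def E_def)
  have a3: "0 \<le> a ^ 3" using a by simp
  have m0: "0 \<le> cubic_min v" "0 \<le> cubic_min p" by auto
  have "e * (2 * p + e) + 2 * a\<^sup>2 * v \<le> 9/2 * a ^ 3 + 9/2 * cubic_min v + 9 * cubic_min p"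
  proof (cases "e \<le> 0")
    case True
    have "e * (2 * p + e) \<le> \<Psi>\<^sup>2 + 2 * \<bar>p\<bar> * \<Psi>"
      by (rule negative_quadratic_bound[OF e_def E0 True])
    also have "\<dots> \<le> 39/10 * a ^ 3 + 9 * cubic_min \<bar>p\<bar>"
      unfolding \<Psi>_def by (rule corr_young_full) (use a in auto)
    finally show ?thesis using cross_term_bound_sharp[OF a v] a3 by simp
  next
    case e: False
    show ?thesis
    proof (cases "1 \<le> s")
      case True
      have "\<exists>M\<in>{v, - p}. v \<le> M \<and> - p \<le> M" by (cases "v \<le> - p") auto
      then obtain M where M: "M \<in> {v, - p}" "v \<le> M" "- p \<le> M" by blast
      have "e * (2 * p + e) \<le> (1 + 1/2)\<^sup>2 * cubic_min M"
        by (rule far_pair_bound[OF True, where c = "v / 2" and u = "- a" and v = v])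
          (use M a v e eE ss in auto)
      then have "e * (2 * p + e) \<le> 9/4 * cubic_min M" by (simp add: power2_eq_square)
      moreover have "cubic_min M \<le> cubic_min v + cubic_min p"
        using M(1) by (auto simp: add_increasing add_increasing2)
      ultimately show ?thesis using cross_term_bound[OF a v] a3 m0 by linarith
    next
      case s1: False
      show ?thesis
      proof (cases "p \<le> 0")
        case True
        have "e * (2 * p + e) \<le> a ^ 3 / 4"
          by (rule near_obtuse_pair_bound[where u = "- a" and v = v and s = s])
            (use True s0 s1 e eE ss v in auto)
        then show ?thesis using cross_term_bound[OF a v] a3 m0 by linarith
      next
        case p: False
        define t where "t = 1 - s"
        have t: "0 \<le> t" "t \<le> 1" using s0 s1 by (auto simp: t_def)
        have tp: "t - t\<^sup>2 / 2 = p + a / 2 - v / 2"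
          using ss by (simp add: t_def power2_eq_square field_simps)
        have et: "e = t\<^sup>2 / 2 - 4 * a\<^sup>2 + 6 * a ^ 3"
          by (simp add: e_def E_def \<Psi>_def t_def power2_eq_square power3_eq_cube algebra_simps)
        have "e * (2 * p + e) \<le> 9 * cubic_min p + 39/10 * a ^ 3"
          by (rule close_mixed_pair_bound[where t = t]) (use p e a t tp et v in auto)
        then show ?thesis using cross_term_bound_sharp[OF a v] a3 by linarith
      qed
    qed
  qed
  then show ?thesis by (simp add: e_def)
qed


text \<open>Writing \<open>a = c + d\<close> and \<open>b = c - d\<close>, the terms in \<open>d\<close> only help, which leaves the diagonal case
  \<open>d = 0\<close>.\<close>

lemma close_neg_neg_pair_bound:
  fixes t a b e p :: real
  assumes t: "0 \<le> t" "t \<le> 1" and a: "0 \<le> a" "a \<le> 1/2" and b: "0 \<le> b" "b \<le> 1/2"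
    and p: "0 \<le> p" "p = t - t\<^sup>2 / 2 - (a + b) / 2"
    and e: "0 \<le> e" "e = t\<^sup>2 / 2 - a\<^sup>2 * (4 - 6 * a) - b\<^sup>2 * (4 - 6 * b)"
  shows "e * (2 * p + e) \<le> 9 * p ^ 3 + 9/2 * a ^ 3 + 9/2 * b ^ 3 + 2 * a * b * (a + b)"
proof -
  define c where "c = (a + b) / 2"
  define d where "d = (a - b) / 2"
  have ab: "a = c + d" "b = c - d" by (auto simp: c_def d_def field_simps)
  have c: "0 \<le> c" "c \<le> 1/2" using a b by (auto simp: c_def)
  define E where "E = t\<^sup>2 / 2 - 8 * c\<^sup>2 + 12 * c ^ 3"
  \<comment> \<open>The effect of asymmetry on the corrections; it can be positive only for
    \<open>c > 2/9\<close>.\<close>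
  define \<Delta> where "\<Delta> = (36 * c - 8) * d\<^sup>2"
  have eE: "e = E + \<Delta>"
    unfolding e(2) E_def \<Delta>_def ab by (simp add: power2_eq_square power3_eq_cube algebra_simps)
  have R: "9/2 * a ^ 3 + 9/2 * b ^ 3 + 2 * a * b * (a + b) = 13 * c ^ 3 + 23 * c * d\<^sup>2"
    unfolding ab by (simp add: power2_eq_square power3_eq_cube algebra_simps)
  \<comment> \<open>\<open>close_pair_bound\<close> needs a nonnegative excess, and truncating
    \<open>E\<close> at 0 keeps its conclusion.\<close>
  define M where "M = max E 0"
  have M0: "0 \<le> M" by (simp add: M_def)
  have pc: "p = t - t\<^sup>2 / 2 - c" by (simp add: p c_def)
  have M: "M * (2 * p + M) \<le> 9 * p ^ 3 + 13 * c ^ 3"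
  proof (cases "0 \<le> E")
    case True
    then show ?thesis unfolding M_def E_def pc
      using close_pair_bound[OF t c(1)] p(1) by (simp add: E_def pc)
  next
    case False
    then show ?thesis using p c by (simp add: M_def)
  qed
  have "0 \<le> c\<^sup>2 * (8 - 12 * c)" using c by simp
  then have Et: "E \<le> t\<^sup>2 / 2" by (simp add: E_def power2_eq_square power3_eq_cube algebra_simps)
  have "0 \<le> a\<^sup>2 * (4 - 6 * a)" "0 \<le> b\<^sup>2 * (4 - 6 * b)" using a b by auto
  then have et: "e \<le> t\<^sup>2 / 2" using e by linarith
  have Mt: "M \<le> t\<^sup>2 / 2" using Et by (simp add: M_def max_def)
  have "e * (2 * p + e) \<le> 9 * p ^ 3 + 13 * c ^ 3 + 23 * c * d\<^sup>2"
  proof (cases "e \<le> M")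
    case True
    have "e * (2 * p + e) \<le> M * (2 * p + M)" using e True p by (intro quadratic_mono_bound) auto
    moreover have "0 \<le> 23 * c * d\<^sup>2" using c by simp
    ultimately show ?thesis using M by linarith
  next
    case False
    have "e - M \<le> \<Delta>" by (simp add: eE M_def)
    \<comment> \<open>The claim below amounts to
      \<open>72 * c\<^sup>2 - 65 * c + 16 \<ge> 0\<close>, a parabola with vertex
      \<open>65/144\<close>.\<close>
    have "0 \<le> (c - 65/144)\<^sup>2" by simp
    then have quad: "(36 * c - 8) * (2 - 2 * c) \<le> 23 * c" by (simp add: power2_eq_square algebra_simps)
    have "2 * p + e + M \<le> 2 * t - 2 * c" using et Mt pc by simp
    then have le: "2 * p + e + M \<le> 2 - 2 * c" using t by simp
    have "e * (2 * p + e) = M * (2 * p + M) + (e - M) * (2 * p + e + M)" by (simp add: algebra_simps)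
    also have "\<dots> \<le> M * (2 * p + M) + \<Delta> * (2 - 2 * c)"
      using False le \<open>e - M \<le> \<Delta>\<close> p M0 by (intro add_left_mono mult_mono) auto
    also have "\<Delta> * (2 - 2 * c) = ((36 * c - 8) * (2 - 2 * c)) * d\<^sup>2" by (simp add: \<Delta>_def)
    also have "\<dots> \<le> 23 * c * d\<^sup>2" using quad by (intro mult_right_mono) auto
    finally show ?thesis using M by linarith
  qed
  then show ?thesis using R by linarith
qed

text \<open>Squaring the sum of two corrections creates this product, and the mean-zero terms pay
  for it. The inequality of arithmetic and geometric means, applied to the squares of
  \<open>a * (4 - 6 * a)\<close> and \<open>b * (4 - 6 * b)\<close>, reduces it to one
  variable.\<close>

lemma corr_product_bound:
  fixes a b :: real
  assumes a: "0 \<le> a" "a \<le> 1/2" and b: "0 \<le> b" "b \<le> 1/2"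
  shows "(a\<^sup>2 * (4 - 6 * a)) * (b\<^sup>2 * (4 - 6 * b)) \<le> a * b * (a + b)"
proof -
  have sq: "(x * (4 - 6 * x))\<^sup>2 \<le> 2 * x" if "0 \<le> x" "x \<le> 1/2" for x :: real
  proof -
    \<comment> \<open>On the interval \<open>x * (4 - 6 * x)\<^sup>2\<close> attains its maximum
      \<open>128/81\<close> at \<open>x = 2/9\<close>, below the needed 2.\<close>
    have "0 \<le> x * ((x - 2/9)\<^sup>2 * (32 - 36 * x) + 2/5)" using that by simp
    then show ?thesis using that by (simp add: power2_eq_square algebra_simps)
  qed
  define X where "X = a * (4 - 6 * a)"
  define Y where "Y = b * (4 - 6 * b)"
  have "0 \<le> (X - Y)\<^sup>2" by simp
  then have "2 * (X * Y) \<le> X\<^sup>2 + Y\<^sup>2" by (simp add: power2_diff)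
  then have "X * Y \<le> a + b" using sq[OF a] sq[OF b] by (simp add: X_def Y_def)
  then have "(a * b) * (X * Y) \<le> (a * b) * (a + b)" using a b by (intro mult_left_mono) auto
  then show ?thesis by (simp add: X_def Y_def power2_eq_square ac_simps)
qed

text \<open>With both deviations negative the mean-zero terms equal
  \<open>- 2 * a * b * (a + b)\<close>, a gain that pays for the interaction of the two corrections
  and for close pairs.\<close>

lemma pointwise_neg_neg:
  fixes a b p s :: real
  assumes s0: "0 \<le> s" and ss: "s\<^sup>2 = 1 - a - b - 2 * p"
    and a: "0 \<le> a" "a \<le> 1/2" and b: "0 \<le> b" "b \<le> 1/2"
  defines "E \<equiv> (1 - s)\<^sup>2 / 2" and "\<Psi> \<equiv> a\<^sup>2 * (4 - 6 * a) + b\<^sup>2 * (4 - 6 * b)"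
  shows "(E - \<Psi>) * (2 * p + (E - \<Psi>)) - 2 * a * b * (a + b)
    \<le> 9/2 * a ^ 3 + 9/2 * b ^ 3 + 9 * cubic_min p"
proof -
  define e where "e = E - \<Psi>"
  have E0: "0 \<le> E" by (simp add: E_def)
  have P0: "0 \<le> \<Psi>" using a b by (simp add: \<Psi>_def)
  have eE: "e \<le> (1 - s)\<^sup>2 / 2" using P0 by (simp add: e_def E_def)
  have nn: "0 \<le> a ^ 3" "0 \<le> b ^ 3" "0 \<le> a * b * (a + b)" "0 \<le> cubic_min p" using a b by auto
  have "e * (2 * p + e) \<le> 9/2 * a ^ 3 + 9/2 * b ^ 3 + 9 * cubic_min p + 2 * (a * b * (a + b))"
  proof (cases "e \<le> 0")
    case True
    have "e * (2 * p + e) \<le> \<Psi>\<^sup>2 + 2 * \<bar>p\<bar> * \<Psi>"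
      by (rule negative_quadratic_bound[OF e_def E0 True])
    also have "\<dots> = ((a\<^sup>2 * (4 - 6 * a))\<^sup>2 + 2 * \<bar>p\<bar> * (a\<^sup>2 * (4 - 6 * a)))
        + ((b\<^sup>2 * (4 - 6 * b))\<^sup>2 + 2 * \<bar>p\<bar> * (b\<^sup>2 * (4 - 6 * b)))
        + 2 * ((a\<^sup>2 * (4 - 6 * a)) * (b\<^sup>2 * (4 - 6 * b)))"
      unfolding \<Psi>_def power2_sum by (simp add: distrib_left)
    also have "\<dots> \<le> (9/2 * a ^ 3 + 9/2 * cubic_min \<bar>p\<bar>) + (9/2 * b ^ 3 + 9/2 * cubic_min \<bar>p\<bar>)
        + 2 * (a * b * (a + b))"
      by (intro add_mono mult_left_mono corr_product_bound corr_young_half) (use a b in auto)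
    finally show ?thesis by simp
  next
    case e: False
    show ?thesis
    proof (cases "1 \<le> s")
      case True
      have "e * (2 * p + e) \<le> (1 + 1/2)\<^sup>2 * cubic_min (max 0 (- p))"
        by (rule far_pair_bound[OF True, where c = 0 and u = "- a" and v = "- b"])
          (use a b e eE ss in auto)
      then have "e * (2 * p + e) \<le> 9/4 * cubic_min (max 0 (- p))" by (simp add: power2_eq_square)
      moreover have "cubic_min (max 0 (- p)) \<le> cubic_min p"
        by (simp add: max_def) (simp add: cubic_min_def)
      ultimately show ?thesis using nn by linarith
    next
      case s1: False
      show ?thesis
      proof (cases "p \<le> 0")
        case True
        have "e * (2 * p + e) \<le> (a + b) ^ 3 / 4"
          by (rule near_obtuse_pair_bound[where u = "- a" and v = "- b" and s = s])
            (use True s0 s1 e eE ss in auto)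
        moreover have "(a + b) ^ 3 / 4 \<le> a ^ 3 + b ^ 3"
        proof -
          have "0 \<le> (a + b) * (a - b)\<^sup>2" using a b by simp
          then show ?thesis by (simp add: power2_eq_square power3_eq_cube algebra_simps)
        qed
        ultimately show ?thesis using nn by linarith
      next
        case p: False
        define t where "t = 1 - s"
        have t: "0 \<le> t" "t \<le> 1" using s0 s1 by (auto simp: t_def)
        have tp: "p = t - t\<^sup>2 / 2 - (a + b) / 2"
          using ss by (simp add: t_def power2_eq_square field_simps)
        have "0 \<le> (1 - t)\<^sup>2" by simp
        then have "t - t\<^sup>2 / 2 \<le> 1/2" by (simp add: power2_eq_square algebra_simps)
        then have "p \<le> 1" using tp a b by (simp add: field_simps)
        have et: "e = t\<^sup>2 / 2 - a\<^sup>2 * (4 - 6 * a) - b\<^sup>2 * (4 - 6 * b)"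
          by (simp add: e_def E_def \<Psi>_def t_def)
        have "e * (2 * p + e) \<le> 9 * p ^ 3 + 9/2 * a ^ 3 + 9/2 * b ^ 3 + 2 * a * b * (a + b)"
          by (rule close_neg_neg_pair_bound[OF t a b _ tp _ et]) (use p e in auto)
        then show ?thesis using p \<open>p \<le> 1\<close> by (simp add: cubic_min_small mult.assoc)
      qed
    qed
  qed
  then show ?thesis by (simp add: e_def algebra_simps)
qed

text \<open>\<open>e * (2 * p + e)\<close> is \<open>(p + e)\<^sup>2 - p\<^sup>2\<close>, and
  \<open>p + e\<close> is minus the distance recentred by the chosen function of each endpoint. The
  lower limit \<open>- 1/2\<close> on the deviations is nonnegativity of the squared norms.\<close>

lemma pointwise_upper:
  fixes u v p s :: real
  assumes "0 \<le> s" and ss: "s\<^sup>2 = 1 + u + v - 2 * p" and u: "- 1/2 \<le> u" and v: "- 1/2 \<le> v"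
  defines "e \<equiv> (1 - s)\<^sup>2 / 2 - corr u - corr v"
  shows "e * (2 * p + e) + 2 * (neg_sq u * v + neg_sq v * u)
    \<le> 9/2 * cubic_min u + 9/2 * cubic_min v + 9 * cubic_min p"
proof -
  have neg: "cubic_min x = (- x) ^ 3" if "x < 0" "- 1/2 \<le> x" for x
    using cubic_min_small[of "- x"] that by simp
  consider "0 \<le> u" "0 \<le> v" | "u < 0" "0 \<le> v" | "0 \<le> u" "v < 0" | "u < 0" "v < 0" by linarith
  then show ?thesis
  proof cases
    case 1
    then show ?thesis using pointwise_nonneg[of s u v p] assms
      by (simp add: e_def corr_def neg_sq_def)
  next
    case 2
    then show ?thesis using pointwise_mixed[of s "- u" v p] assms neg[of u]
      by (simp add: e_def corr_def neg_sq_def ac_simps)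
  next
    case 3
    then show ?thesis using pointwise_mixed[of s "- v" u p] assms neg[of v]
      by (simp add: e_def corr_def neg_sq_def ac_simps)
  next
    case 4
    then show ?thesis using pointwise_neg_neg[of s "- u" "- v" p] assms neg[of v] neg[of u]
      by (simp add: e_def corr_def neg_sq_def power2_eq_square algebra_simps)
  qed
qed

text \<open>Only negative \<open>p\<close> costs anything. There \<open>(1 - s)\<^sup>2\<close> is
  at most \<open>4 * M\<close> and at most \<open>4 * M\<^sup>2\<close> for the largest
  \<open>M\<close> of \<open>\<bar>u\<bar>\<close>, \<open>\<bar>v\<bar>\<close> and
  \<open>- p\<close>, so the constant 4 already suffices.\<close>

lemma pointwise_lower:
  fixes u v p s :: real
  assumes "0 \<le> s" and ss: "s\<^sup>2 = 1 + u + v - 2 * p" and u: "- 1/2 \<le> u" and v: "- 1/2 \<le> v"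
  shows "- p * (1 - s)\<^sup>2 \<le> 9/2 * cubic_min u + 9/2 * cubic_min v + 9 * cubic_min p"
proof -
  have nn: "0 \<le> cubic_min u" "0 \<le> cubic_min v" "0 \<le> cubic_min p" by auto
  show ?thesis
  proof (cases "0 \<le> p")
    case True
    then have "- p * (1 - s)\<^sup>2 \<le> 0" by simp
    then show ?thesis using nn by linarith
  next
    case p: False
    define M where "M = max \<bar>u\<bar> (max \<bar>v\<bar> (- p))"
    have M: "\<bar>u\<bar> \<le> M" "\<bar>v\<bar> \<le> M" "- p \<le> M" "0 \<le> M" using p by (auto simp: M_def)
    have MM: "cubic_min M \<le> cubic_min u + cubic_min v + cubic_min p"
      using nn by (auto simp: M_def max_def)
    have b: "(1 - s)\<^sup>2 \<le> 4 * M\<^sup>2 \<and> (1 - s)\<^sup>2 \<le> 4 * M"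
    proof (cases "1 \<le> s")
      case True
      have eq: "(1 - s)\<^sup>2 + 2 * s - 2 = u + v - 2 * p"
        using ss by (simp add: power2_eq_square algebra_simps)
      have "0 \<le> (1 - s)\<^sup>2" by simp
      then have "s - 1 \<le> 2 * M" "(1 - s)\<^sup>2 \<le> 4 * M" using eq M True
        abs_ge_self[of u] abs_ge_self[of v] by linarith+
      moreover have "(s - 1)\<^sup>2 \<le> (2 * M)\<^sup>2" using \<open>s - 1 \<le> 2 * M\<close> True by (intro power_mono) auto
      ultimately show ?thesis by (simp add: power2_commute power_mult_distrib)
    next
      case False
      define t where "t = 1 - s"
      have t: "0 \<le> t" "t \<le> 1" using False assms by (auto simp: t_def)
      have "t * 1 \<le> t * (2 - t)" using t by (intro mult_left_mono) auto
      also have "t * (2 - t) = 2 * p - u - v" using ss by (simp add: t_def power2_eq_square algebra_simps)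
      finally have t2: "t \<le> 2 * M" using M p by linarith
      then have "t\<^sup>2 \<le> (2 * M)\<^sup>2" using t by (intro power_mono) auto
      moreover have "t\<^sup>2 \<le> t" using t by (simp add: power2_eq_square mult_left_le)
      ultimately show ?thesis using t2 M(4) unfolding t_def power_mult_distrib by simp
    qed
    have "- p * (1 - s)\<^sup>2 \<le> 4 * cubic_min M"
    proof (rule le_cubic_minI)
      have "- p * (1 - s)\<^sup>2 \<le> M * (4 * M\<^sup>2)" using b M p by (intro mult_mono) auto
      then show "- p * (1 - s)\<^sup>2 \<le> 4 * M ^ 3" by (simp add: power2_eq_square power3_eq_cube)
      have "- p * (1 - s)\<^sup>2 \<le> M * (4 * M)" using b M p by (intro mult_mono) auto
      then show "- p * (1 - s)\<^sup>2 \<le> 4 * M\<^sup>2" by (simp add: power2_eq_square)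
    qed (use M in auto)
    then show ?thesis using MM nn by linarith
  qed
qed


section \<open>Conditional expectations of independent pairs\<close>

lemma indep_var_joint_distr:
  assumes "prob_space N" and "prob_space.indep_var N S X1 T X2"
  shows "distr N (S \<Otimes>\<^sub>M T) (\<lambda>\<omega>. (X1 \<omega>, X2 \<omega>)) = distr N S X1 \<Otimes>\<^sub>M distr N T X2"
  using assms prob_space.indep_var_distribution_eq by metis

text \<open>Swapping the factors of the joint law lets conditioning on \<open>X2\<close> reuse the
  result for \<open>X1\<close>.\<close>

lemma indep_var_swap:
  assumes N: "prob_space N" and ind: "prob_space.indep_var N S X1 T X2"
  shows "prob_space.indep_var N T X2 S X1"
proof -
  interpret prob_space N by fact
  have m [measurable]: "X1 \<in> measurable N S" "X2 \<in> measurable N T"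
    using ind by (auto dest: indep_var_rv1 indep_var_rv2)
  interpret P: prob_space "distr N S X1" by (rule prob_space_distr) fact
  interpret R: prob_space "distr N T X2" by (rule prob_space_distr) fact
  interpret RP: pair_prob_space "distr N T X2" "distr N S X1" ..
  have "distr N T X2 \<Otimes>\<^sub>M distr N S X1
      = distr (distr N S X1 \<Otimes>\<^sub>M distr N T X2) (distr N T X2 \<Otimes>\<^sub>M distr N S X1) (\<lambda>(x, y). (y, x))"
    by (rule RP.distr_pair_swap)
  also have "\<dots> = distr (distr N (S \<Otimes>\<^sub>M T) (\<lambda>\<omega>. (X1 \<omega>, X2 \<omega>))) (T \<Otimes>\<^sub>M S) (\<lambda>(x, y). (y, x))"
    unfolding indep_var_joint_distr[OF N ind] by (intro distr_cong sets_pair_measure_cong) auto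
  also have "\<dots> = distr N (T \<Otimes>\<^sub>M S) (\<lambda>\<omega>. (X2 \<omega>, X1 \<omega>))"
    by (subst distr_distr) (auto simp: comp_def)
  finally show ?thesis using m by (simp add: indep_var_distribution_eq)
qed

text \<open>Conditioning on one of two independent variables freezes it and integrates out the
  other. By Fubini the partial integral has the right integrals over all events generated by
  \<open>X1\<close>, which characterises the conditional expectation.\<close>

lemma cond_exp_given_indep:
  fixes X1 :: "'b \<Rightarrow> 'c::topological_space" and X2 :: "'b \<Rightarrow> 'c::topological_space"
  assumes N: "prob_space N" and ind: "prob_space.indep_var N borel X1 borel X2"
    and f [measurable]: "f \<in> borel_measurable (borel \<Otimes>\<^sub>M borel)"
    and int: "integrable N (\<lambda>\<omega>. f (X1 \<omega>, X2 \<omega>))"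
  shows "AE \<omega> in N. cond_exp_given N X1 (\<lambda>\<omega>. f (X1 \<omega>, X2 \<omega>)) \<omega>
    = (\<integral>y. f (X1 \<omega>, y) \<partial>distr N borel X2)"
proof -
  interpret prob_space N by fact
  have m [measurable]: "X1 \<in> measurable N borel" "X2 \<in> measurable N borel"
    using ind by (auto dest: indep_var_rv1 indep_var_rv2)
  define P where "P = distr N borel X1"
  define R where "R = distr N borel X2"
  have [measurable_cong]: "sets P = sets borel" "sets R = sets borel" by (simp_all add: P_def R_def)
  interpret P: prob_space P unfolding P_def by (rule prob_space_distr) fact
  interpret R: prob_space R unfolding R_def by (rule prob_space_distr) fact
  interpret PR: pair_prob_space P R ..
  have joint: "P \<Otimes>\<^sub>M R = distr N (borel \<Otimes>\<^sub>M borel) (\<lambda>\<omega>. (X1 \<omega>, X2 \<omega>))"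
    using indep_var_joint_distr[OF N ind] by (simp add: P_def R_def)
  define F where "F = vimage_algebra (space N) X1 (borel :: 'c measure)"
  have F: "subalgebra N F"
    unfolding subalgebra_def F_def by (auto simp: sets_vimage_algebra2 measurable_sets)
  interpret finite_measure_subalgebra N F
    by (intro finite_measure_subalgebra.intro finite_measure_subalgebra_axioms.intro F) unfold_locales
  have X1F: "X1 \<in> measurable F borel" unfolding F_def by (rule measurable_vimage_algebra1) simp
  define g where "g x = (\<integral>y. f (x, y) \<partial>R)" for x
  have g [measurable]: "g \<in> borel_measurable borel" unfolding g_def by measurable
  have fPR: "integrable (P \<Otimes>\<^sub>M R) f"
    unfolding joint by (subst integrable_distr_eq) (use int in auto)
  have gP: "integrable P g" unfolding g_def using PR.integrable_fst'[OF fPR] .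
  have gN: "integrable N (\<lambda>\<omega>. g (X1 \<omega>))"
    using gP unfolding P_def by (subst (asm) integrable_distr_eq) auto
  have "AE \<omega> in N. real_cond_exp N F (\<lambda>\<omega>. f (X1 \<omega>, X2 \<omega>)) \<omega> = g (X1 \<omega>)"
  proof (rule real_cond_exp_charact)
    fix A assume "A \<in> sets F"
    then obtain S where S [measurable]: "S \<in> sets borel" and A: "A = X1 -` S \<inter> space N"
      unfolding F_def by (auto simp: sets_vimage_algebra2)
    have i: "integrable (P \<Otimes>\<^sub>M R) (\<lambda>z. indicator S (fst z) * f z)"
      by (rule Bochner_Integration.integrable_bound[OF fPR]) (auto simp: indicator_def)
    have "(\<integral>\<omega>\<in>A. f (X1 \<omega>, X2 \<omega>) \<partial>N) = (\<integral>\<omega>. indicator S (X1 \<omega>) * f (X1 \<omega>, X2 \<omega>) \<partial>N)"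
      unfolding set_lebesgue_integral_def A
      by (intro Bochner_Integration.integral_cong) (auto simp: indicator_def)
    also have "\<dots> = (\<integral>z. indicator S (fst z) * f z \<partial>(P \<Otimes>\<^sub>M R))"
      unfolding joint by (subst integral_distr) auto
    also have "\<dots> = (\<integral>x. indicator S x * g x \<partial>P)"
      using PR.integral_fst'[OF i] by (simp add: g_def)
    also have "\<dots> = (\<integral>\<omega>. indicator S (X1 \<omega>) * g (X1 \<omega>) \<partial>N)"
      unfolding P_def by (subst integral_distr) auto
    also have "\<dots> = (\<integral>\<omega>\<in>A. g (X1 \<omega>) \<partial>N)"
      unfolding set_lebesgue_integral_def A
      by (intro Bochner_Integration.integral_cong) (auto simp: indicator_def)
    finally show "(\<integral>\<omega>\<in>A. f (X1 \<omega>, X2 \<omega>) \<partial>N) = (\<integral>\<omega>\<in>A. g (X1 \<omega>) \<partial>N)" .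
  qed (use int gN measurable_compose[OF X1F g] in auto)
  then show ?thesis by (simp add: cond_exp_given_def F_def g_def R_def)
qed

section \<open>Double centering\<close>

text \<open>The argument runs on the law of the vector and its square, where independence is a
  product measure and conditional expectations are partial integrals.\<close>

locale quartic_prob = prob_space Q for Q :: "'c::euclidean_space measure" +
  assumes sets_Q [measurable_cong]: "sets Q = sets borel"
    and int4: "integrable Q (\<lambda>x. norm x ^ 4)"
begin

sublocale pair: pair_prob_space Q Q ..

abbreviation Q2 :: "('c \<times> 'c) measure" where "Q2 \<equiv> Q \<Otimes>\<^sub>M Q"

section \<open>Functions of quadratic growth\<close>

text \<open>Such functions form a linear space and, given the fourth moment, products of two of them
  are integrable; this settles the integrability questions on the product space.\<close>

definition quad_growth :: "('c \<times> 'c \<Rightarrow> real) \<Rightarrow> bool" where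
  "quad_growth f \<longleftrightarrow> f \<in> borel_measurable Q2 \<and>
    (\<exists>C. \<forall>z. \<bar>f z\<bar> \<le> C * (1 + norm (fst z) ^ 2 + norm (snd z) ^ 2))"

lemma quad_growthI:
  assumes "f \<in> borel_measurable Q2" "\<And>x y. \<bar>f (x, y)\<bar> \<le> C * (1 + norm x ^ 2 + norm y ^ 2)"
  shows "quad_growth f"
  unfolding quad_growth_def
proof (intro conjI exI allI)
  fix z show "\<bar>f z\<bar> \<le> C * (1 + norm (fst z) ^ 2 + norm (snd z) ^ 2)"
    using assms(2)[of "fst z" "snd z"] by simp
qed (rule assms)

lemma quad_growth_meas: "quad_growth f \<Longrightarrow> f \<in> borel_measurable Q2"
  by (simp add: quad_growth_def)

lemma quad_growth_bound:
  assumes "quad_growth f"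
  shows "\<exists>C\<ge>0. \<forall>x y. \<bar>f (x, y)\<bar> \<le> C * (1 + norm x ^ 2 + norm y ^ 2)"
proof -
  obtain C where C: "\<And>z. \<bar>f z\<bar> \<le> C * (1 + norm (fst z) ^ 2 + norm (snd z) ^ 2)"
    using assms unfolding quad_growth_def by blast
  have "0 \<le> C" using C[of "(0, 0)"] by simp
  moreover have "\<bar>f (x, y)\<bar> \<le> C * (1 + norm x ^ 2 + norm y ^ 2)" for x y
    using C[of "(x, y)"] by simp
  ultimately show ?thesis by blast
qed

lemma quad_growth_const [simp]: "quad_growth (\<lambda>z. c)"
  by (rule quad_growthI[where C = "\<bar>c\<bar>"]) (auto simp: algebra_simps)

lemma quad_growth_add [intro]:
  assumes "quad_growth f" "quad_growth h"
  shows "quad_growth (\<lambda>z. f z + h z)"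
proof -
  obtain C where C: "\<And>x y. \<bar>f (x, y)\<bar> \<le> C * (1 + norm x ^ 2 + norm y ^ 2)"
    using quad_growth_bound[OF assms(1)] by blast
  obtain D where D: "\<And>x y. \<bar>h (x, y)\<bar> \<le> D * (1 + norm x ^ 2 + norm y ^ 2)"
    using quad_growth_bound[OF assms(2)] by blast
  show ?thesis
  proof (rule quad_growthI[where C = "C + D"])
    show "(\<lambda>z. f z + h z) \<in> borel_measurable Q2"
      using assms[THEN quad_growth_meas] by simp
    show "\<bar>f (x, y) + h (x, y)\<bar> \<le> (C + D) * (1 + norm x ^ 2 + norm y ^ 2)" for x y
      using C[of x y] D[of x y] abs_triangle_ineq[of "f (x, y)" "h (x, y)"]
      unfolding distrib_right[of C D] by linarith
  qed
qed

lemma quad_growth_cmult [intro]: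
  assumes "quad_growth f"
  shows "quad_growth (\<lambda>z. c * f z)"
proof -
  obtain C where C: "\<And>x y. \<bar>f (x, y)\<bar> \<le> C * (1 + norm x ^ 2 + norm y ^ 2)"
    using quad_growth_bound[OF assms] by blast
  show ?thesis
  proof (rule quad_growthI[where C = "\<bar>c\<bar> * C"])
    show "(\<lambda>z. c * f z) \<in> borel_measurable Q2" using quad_growth_meas[OF assms] by simp
    show "\<bar>c * f (x, y)\<bar> \<le> \<bar>c\<bar> * C * (1 + norm x ^ 2 + norm y ^ 2)" for x y
      unfolding abs_mult mult.assoc using C[of x y] by (intro mult_left_mono) auto
  qed
qed

lemma quad_growth_minus [intro]: "quad_growth f \<Longrightarrow> quad_growth (\<lambda>z. - f z)"
  using quad_growth_cmult[of f "-1"] by simp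

lemma quad_growth_diff [intro]:
  "quad_growth f \<Longrightarrow> quad_growth h \<Longrightarrow> quad_growth (\<lambda>z. f z - h z)"
  using quad_growth_add[of f "\<lambda>z. - h z"] quad_growth_minus[of h] by simp

lemma int4_fst: "integrable Q2 (\<lambda>z. norm (fst z) ^ 4)"
proof (rule integrable_distr[of fst Q2 Q "\<lambda>x. norm x ^ 4"])
  show "integrable (distr Q2 Q fst) (\<lambda>x. norm x ^ 4)" by (simp add: distr_pair_fst int4)
qed simp

lemma int4_snd: "integrable Q2 (\<lambda>z. norm (snd z) ^ 4)"
  using pair.integrable_product_swap[OF int4_fst] by (simp add: case_prod_beta')

lemma integrable_product:
  assumes "quad_growth f" "quad_growth h"
  shows "integrable Q2 (\<lambda>z. f z * h z)"
proof -
  obtain C where C: "0 \<le> C" "\<And>x y. \<bar>f (x, y)\<bar> \<le> C * (1 + norm x ^ 2 + norm y ^ 2)"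
    using quad_growth_bound[OF assms(1)] by blast
  obtain D where D: "0 \<le> D" "\<And>x y. \<bar>h (x, y)\<bar> \<le> D * (1 + norm x ^ 2 + norm y ^ 2)"
    using quad_growth_bound[OF assms(2)] by blast
  have i: "integrable Q2 (\<lambda>z. C * D * (3 * (1 + norm (fst z) ^ 4 + norm (snd z) ^ 4)))"
    by (intro integrable_mult_right Bochner_Integration.integrable_add int4_fst int4_snd) simp
  have m: "(\<lambda>z. f z * h z) \<in> borel_measurable Q2"
    using assms[THEN quad_growth_meas] by simp
  show ?thesis
  proof (rule Bochner_Integration.integrable_bound[OF i m], intro AE_I2)
    fix z :: "'c \<times> 'c"
    obtain x y where z: "z = (x, y)" by (cases z)
    define a where "a = norm x ^ 2"
    define b where "b = norm y ^ 2"
    have "\<bar>f z * h z\<bar> \<le> (C * (1 + a + b)) * (D * (1 + a + b))"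
      unfolding z abs_mult a_def b_def using C D by (intro mult_mono mult_nonneg_nonneg add_nonneg_nonneg) auto
    also have "\<dots> = C * D * (1 + a + b)\<^sup>2" by (simp add: power2_eq_square)
    also have "(1 + a + b)\<^sup>2 \<le> 3 * (1 + a\<^sup>2 + b\<^sup>2)"
      using sum_squares_bound[of a b] sum_squares_bound[of 1 a] sum_squares_bound[of 1 b]
      by (simp add: power2_eq_square algebra_simps)
    finally have "\<bar>f z * h z\<bar> \<le> C * D * (3 * (1 + a\<^sup>2 + b\<^sup>2))"
      using C(1) D(1) by (simp add: mult_left_mono)
    then show "norm (f z * h z) \<le> norm (C * D * (3 * (1 + norm (fst z) ^ 4 + norm (snd z) ^ 4)))"
      using C(1) D(1) by (simp add: a_def b_def z)
  qed
qed

lemma quad_growth_integrable: "quad_growth f \<Longrightarrow> integrable Q2 f"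
  using integrable_product[of f "\<lambda>_. 1"] by simp

text \<open>Fubini: integrating out the second variable first kills \<open>k\<close>, the factor
  \<open>a\<close> being constant there.\<close>

lemma orthogonal_fst:
  assumes k: "quad_growth k" and a: "quad_growth (\<lambda>z. a (fst z))"
    and z: "\<And>x. (\<integral>y. k (x, y) \<partial>Q) = 0"
  shows "(\<integral>z. k z * a (fst z) \<partial>Q2) = 0"
  using pair.integral_fst'[OF integrable_product[OF k a]] by (simp add: z)

lemma orthogonal_snd:
  assumes k: "quad_growth k" and a: "quad_growth (\<lambda>z. a (snd z))"
    and z: "\<And>y. (\<integral>x. k (x, y) \<partial>Q) = 0"
  shows "(\<integral>z. k z * a (snd z) \<partial>Q2) = 0"
proof -
  have "integrable Q2 (\<lambda>(x, y). k (x, y) * a y)"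
    using integrable_product[OF k a] by (simp add: case_prod_beta')
  from pair.integral_snd[OF this] show ?thesis by (simp add: z case_prod_beta')
qed


lemma integrable_quadratic:
  fixes f :: "'c \<Rightarrow> 'd::{banach, second_countable_topology}"
  assumes [measurable]: "f \<in> borel_measurable borel" and b: "\<And>x. norm (f x) \<le> C * (1 + norm x ^ 2)"
  shows "integrable Q f"
proof -
  have "integrable Q (\<lambda>x. C * (2 + norm x ^ 4))" using int4 by simp
  then show ?thesis
  proof (rule Bochner_Integration.integrable_bound)
    show "AE x in Q. norm (f x) \<le> norm (C * (2 + norm x ^ 4))"
    proof (rule AE_I2)
      fix x :: 'c
      have "0 \<le> C" using order_trans[OF norm_ge_zero b[of 0]] by simp
      have "2 * norm x ^ 2 \<le> 1 + norm x ^ 4" using sum_squares_bound[of 1 "norm x ^ 2"] by simp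
      moreover have "0 \<le> norm x ^ 2" by simp
      ultimately have "norm x ^ 2 \<le> 1 + norm x ^ 4" by linarith
      then have "C * (1 + norm x ^ 2) \<le> C * (2 + norm x ^ 4)" using \<open>0 \<le> C\<close> by (intro mult_left_mono) auto
      then show "norm (f x) \<le> norm (C * (2 + norm x ^ 4))" using b[of x] \<open>0 \<le> C\<close> by simp
    qed
  qed measurable
qed

lemma quad_growth_fst:
  assumes [measurable]: "a \<in> borel_measurable borel" and b: "\<And>x. \<bar>a x\<bar> \<le> C * (1 + norm x ^ 2)"
  shows "quad_growth (\<lambda>z. a (fst z))"
proof (rule quad_growthI[where C = C])
  fix x y :: 'c
  have "0 \<le> C" using order_trans[OF abs_ge_zero b[of 0]] by simp
  then have "C * (1 + norm x ^ 2) \<le> C * (1 + norm x ^ 2 + norm y ^ 2)" by (intro mult_left_mono) auto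
  then show "\<bar>a (fst (x, y))\<bar> \<le> C * (1 + norm x ^ 2 + norm y ^ 2)" using b[of x] by simp
qed measurable

lemma quad_growth_snd:
  assumes [measurable]: "a \<in> borel_measurable borel" and b: "\<And>x. \<bar>a x\<bar> \<le> C * (1 + norm x ^ 2)"
  shows "quad_growth (\<lambda>z. a (snd z))"
proof (rule quad_growthI[where C = C])
  fix x y :: 'c
  have "0 \<le> C" using order_trans[OF abs_ge_zero b[of 0]] by simp
  then have "C * (1 + norm y ^ 2) \<le> C * (1 + norm x ^ 2 + norm y ^ 2)" by (intro mult_left_mono) auto
  then show "\<bar>a (snd (x, y))\<bar> \<le> C * (1 + norm x ^ 2 + norm y ^ 2)" using b[of y] by simp
qed measurable

section \<open>The double-centered distance\<close>

definition mean_dist :: "'c \<Rightarrow> real" where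
  "mean_dist x = (\<integral>y. norm (x - y) \<partial>Q)"

text \<open>An everywhere defined version: partial integrals replace conditional expectations, which
  are fixed only up to null sets, so its partial means vanish at every point.\<close>

definition centered :: "'c \<times> 'c \<Rightarrow> real" where
  "centered z = norm (fst z - snd z) - mean_dist (fst z) - mean_dist (snd z) + (\<integral>x. mean_dist x \<partial>Q)"

lemma norm_le_quadratic: "norm (x :: 'c) \<le> 1 + norm x ^ 2"
proof -
  have "2 * norm x \<le> 1 + norm x ^ 2" using sum_squares_bound[of 1 "norm x"] by simp
  then show ?thesis using norm_ge_zero[of x] by linarith
qed

lemma mean_dist_measurable [measurable]: "mean_dist \<in> borel_measurable borel"
  unfolding mean_dist_def by measurable

lemma integrable_dist: "integrable Q (\<lambda>y. norm (x - y))"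
proof (rule integrable_quadratic[where C = "norm x + 1"])
  fix y :: 'c
  have "0 \<le> norm x * norm y ^ 2" by simp
  then have "norm (x - y) \<le> norm x + 1 + norm y ^ 2 + norm x * norm y ^ 2"
    using norm_triangle_ineq4[of x y] norm_le_quadratic[of y] by linarith
  then show "norm (norm (x - y)) \<le> (norm x + 1) * (1 + norm y ^ 2)" by (simp add: algebra_simps)
qed measurable

lemma mean_dist_bound: "\<bar>mean_dist x\<bar> \<le> (1 + (\<integral>y. norm y \<partial>Q)) * (1 + norm x ^ 2)"
proof -
  have i: "integrable Q (\<lambda>y. norm y)"
    by (rule integrable_quadratic[where C = 1]) (use norm_le_quadratic in auto)
  have "0 \<le> mean_dist x" unfolding mean_dist_def by simp
  moreover have "mean_dist x \<le> (\<integral>y. norm x + norm y \<partial>Q)"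
    unfolding mean_dist_def using i by (intro integral_mono integrable_dist norm_triangle_ineq4) auto
  moreover have "(\<integral>y. norm x + norm y \<partial>Q) = norm x + (\<integral>y. norm y \<partial>Q)" using i by (simp add: prob_space)
  moreover have "0 \<le> (\<integral>y. norm y \<partial>Q)" by simp
  moreover from this have "(\<integral>y. norm y \<partial>Q) \<le> (\<integral>y. norm y \<partial>Q) * (1 + norm x ^ 2)"
    by (simp add: algebra_simps)
  ultimately show ?thesis using norm_le_quadratic[of x] unfolding distrib_right[of 1] mult_1 by linarith
qed

lemma integrable_mean_dist: "integrable Q mean_dist"
  by (rule integrable_quadratic[OF mean_dist_measurable]) (use mean_dist_bound in auto)

lemma quad_growth_dist: "quad_growth (\<lambda>z. norm (fst z - snd z))"
proof (rule quad_growthI[where C = 2])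
  fix x y :: 'c
  have "0 \<le> norm x ^ 2" "0 \<le> norm y ^ 2" by simp_all
  then have "norm (x - y) \<le> 2 + 2 * norm x ^ 2 + 2 * norm y ^ 2"
    using norm_triangle_ineq4[of x y] norm_le_quadratic[of x] norm_le_quadratic[of y] by linarith
  then show "\<bar>norm (fst (x, y) - snd (x, y))\<bar> \<le> 2 * (1 + norm x ^ 2 + norm y ^ 2)" by simp
qed measurable

lemma quad_growth_mean_dist:
  "quad_growth (\<lambda>z. mean_dist (fst z))" "quad_growth (\<lambda>z. mean_dist (snd z))"
  by (rule quad_growth_fst quad_growth_snd, measurable, rule mean_dist_bound)+

lemma quad_growth_centered: "quad_growth centered"
  unfolding centered_def [abs_def]
  by (intro quad_growth_add quad_growth_diff quad_growth_dist quad_growth_mean_dist quad_growth_const)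

lemma centered_integral_snd: "(\<integral>y. centered (x, y) \<partial>Q) = 0"
  unfolding centered_def using integrable_dist[of x] integrable_mean_dist
  by (simp add: prob_space mean_dist_def[symmetric])

lemma centered_integral_fst: "(\<integral>x. centered (x, y) \<partial>Q) = 0"
proof -
  have "centered (x, y) = centered (y, x)" for x by (simp add: centered_def norm_minus_commute)
  then show ?thesis using centered_integral_snd by simp
qed

lemma quad_growth_inner: "quad_growth (\<lambda>z. fst z \<bullet> snd z)"
proof (rule quad_growthI[where C = 1])
  fix x y :: 'c
  have "\<bar>x \<bullet> y\<bar> \<le> norm x * norm y" by (rule Cauchy_Schwarz_ineq2)
  also have "2 * (norm x * norm y) \<le> norm x ^ 2 + norm y ^ 2"
    using sum_squares_bound[of "norm x" "norm y"] by (simp add: mult.assoc)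
  finally show "\<bar>fst (x, y) \<bullet> snd (x, y)\<bar> \<le> 1 * (1 + norm x ^ 2 + norm y ^ 2)" by simp
qed measurable

text \<open>Pythagoras: the two functions differ by a sum of functions of one variable, and these
  are orthogonal to \<open>centered\<close>.\<close>

lemma centered_sq_le:
  assumes [measurable]: "\<phi> \<in> borel_measurable borel" and b: "\<And>x. \<bar>\<phi> x\<bar> \<le> C * (1 + norm x ^ 2)"
  shows "(\<integral>z. (centered z)\<^sup>2 \<partial>Q2) \<le> (\<integral>z. (norm (fst z - snd z) - \<phi> (fst z) - \<phi> (snd z))\<^sup>2 \<partial>Q2)"
proof -
  define h where "h z = norm (fst z - snd z) - \<phi> (fst z) - \<phi> (snd z)" for z
  define a where "a x = mean_dist x - \<phi> x" for x
  define c where "c = (\<integral>x. mean_dist x \<partial>Q)"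
  note qf = quad_growth_fst[of \<phi>, OF _ b] quad_growth_snd[of \<phi>, OF _ b]
  have qh: "quad_growth h" unfolding h_def [abs_def]
    by (intro quad_growth_diff quad_growth_dist qf) measurable
  have qa: "quad_growth (\<lambda>z. a (fst z))" "quad_growth (\<lambda>z. a (snd z))"
    unfolding a_def by (intro quad_growth_diff quad_growth_mean_dist qf; measurable)+
  have h: "h z = centered z + (a (fst z) + a (snd z) - c)" for z
    by (simp add: h_def a_def c_def centered_def)
  have qd: "quad_growth (\<lambda>z. h z - centered z)" by (intro quad_growth_diff qh quad_growth_centered)
  note i = integrable_product[OF quad_growth_centered qa(1)] integrable_product[OF quad_growth_centered qa(2)]
     integrable_product[OF quad_growth_centered quad_growth_const[of "c"]]
  have "(\<integral>z. centered z * (h z - centered z) \<partial>Q2)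
      = (\<integral>z. centered z * a (fst z) + centered z * a (snd z) - centered z * c \<partial>Q2)"
    by (simp add: h algebra_simps)
  also have "\<dots> = (\<integral>z. centered z * a (fst z) \<partial>Q2) + (\<integral>z. centered z * a (snd z) \<partial>Q2)
      - (\<integral>z. centered z * c \<partial>Q2)"
    using i by simp
  also have "\<dots> = 0"
    using orthogonal_fst[OF quad_growth_centered qa(1) centered_integral_snd]
      orthogonal_snd[OF quad_growth_centered qa(2) centered_integral_fst]
      orthogonal_fst[where a = "\<lambda>_. c", OF quad_growth_centered quad_growth_const centered_integral_snd]
    by simp
  finally have 0: "(\<integral>z. centered z * (h z - centered z) \<partial>Q2) = 0" .
  have "(\<integral>z. (h z)\<^sup>2 \<partial>Q2) = (\<integral>z. centered z * centered z
      + 2 * (centered z * (h z - centered z)) + (h z - centered z) * (h z - centered z) \<partial>Q2)"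
    by (rule Bochner_Integration.integral_cong) (auto simp: power2_eq_square algebra_simps)
  also have "\<dots> = (\<integral>z. centered z * centered z \<partial>Q2) + (\<integral>z. (h z - centered z) * (h z - centered z) \<partial>Q2)"
    using integrable_product[OF quad_growth_centered quad_growth_centered]
      integrable_product[OF quad_growth_centered qd] integrable_product[OF qd qd] 0 by simp
  also have "\<dots> \<ge> (\<integral>z. (centered z)\<^sup>2 \<partial>Q2)" by (simp add: power2_eq_square)
  finally show ?thesis by (simp add: h_def)
qed


lemma inner_integral:
  assumes "(\<integral>x. x \<partial>Q) = 0"
  shows "(\<integral>y. x \<bullet> y \<partial>Q) = 0" "(\<integral>y. y \<bullet> x \<partial>Q) = 0"
proof -
  have "integrable Q (\<lambda>x. x)" by (rule integrable_quadratic[where C = 1]) (use norm_le_quadratic in auto)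
  then show "(\<integral>y. x \<bullet> y \<partial>Q) = 0" "(\<integral>y. y \<bullet> x \<partial>Q) = 0" by (simp_all add: assms)
qed

lemma integral_dist_sq:
  assumes "(\<integral>x. x \<partial>Q) = 0"
  shows "(\<integral>z. norm (fst z - snd z) ^ 2 \<partial>Q2) = 2 * (\<integral>x. norm x ^ 2 \<partial>Q)"
proof -
  have i: "integrable Q (\<lambda>x. norm x ^ 2)" by (rule integrable_quadratic[where C = 1]) auto
  have i': "integrable Q (\<lambda>y. x \<bullet> y)" for x
    by (intro integrable_inner_right integrable_quadratic[where C = 1]) (use norm_le_quadratic in auto)
  have sq: "norm (x - y) ^ 2 = norm x ^ 2 + norm y ^ 2 - 2 * (x \<bullet> y)" for x y :: 'c
    by (simp add: power2_norm_eq_inner inner_diff_left inner_diff_right inner_commute)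
  have "(\<integral>z. norm (fst z - snd z) ^ 2 \<partial>Q2) = (\<integral>x. (\<integral>y. norm (x - y) ^ 2 \<partial>Q) \<partial>Q)"
    using pair.integral_fst'[OF integrable_product[OF quad_growth_dist quad_growth_dist]]
    by (simp add: power2_eq_square)
  also have "\<dots> = (\<integral>x. norm x ^ 2 + (\<integral>y. norm y ^ 2 \<partial>Q) \<partial>Q)"
    unfolding sq using i i' inner_integral[OF assms] by (simp add: prob_space)
  also have "\<dots> = 2 * (\<integral>x. norm x ^ 2 \<partial>Q)" using i by (simp add: prob_space)
  finally show ?thesis .
qed

end


section \<open>Integrated bounds for the normalized law\<close>

lemma cubic_min_measurable [measurable]: "cubic_min \<in> borel_measurable borel"
  unfolding cubic_min_def by measurable

lemma corr_measurable [measurable]: "corr \<in> borel_measurable borel"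
  unfolding corr_def by measurable

lemma neg_sq_measurable [measurable]: "neg_sq \<in> borel_measurable borel"
  unfolding neg_sq_def by measurable

lemma neg_sq_bound: "- 1/2 \<le> u \<Longrightarrow> \<bar>neg_sq u\<bar> \<le> 1"
proof -
  assume "- 1/2 \<le> u"
  then have "u\<^sup>2 \<le> 1" if "u < 0" using that power_mono[of "- u" 1 2] by simp
  then show ?thesis by (simp add: neg_sq_def)
qed

lemma corr_bound: "- 1/2 \<le> u \<Longrightarrow> \<bar>corr u\<bar> \<le> 1"
proof -
  assume u: "- 1/2 \<le> u"
  have "u\<^sup>2 * (4 + 6 * u) \<le> (1/2)\<^sup>2 * 4" if "u < 0"
    using that u power_mono[of "- u" "1/2" 2] by (intro mult_mono) auto
  moreover have "0 \<le> u\<^sup>2 * (4 + 6 * u)" using u by simp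
  ultimately show ?thesis by (simp add: corr_def power2_eq_square)
qed

text \<open>Second moment \<open>1/2\<close> makes the mean squared distance of two independent
  copies equal to 1.\<close>

locale normalized_prob = quartic_prob +
  assumes mean0: "(\<integral>x. x \<partial>Q) = 0"
    and second_moment: "(\<integral>x. norm x ^ 2 \<partial>Q) = 1/2"
begin

definition dev :: "'a \<Rightarrow> real" where "dev x = norm x ^ 2 - 1/2"

lemma dev_measurable [measurable]: "dev \<in> borel_measurable borel"
  unfolding dev_def by measurable

lemma dev_ge: "- 1/2 \<le> dev x"
  by (simp add: dev_def)

lemma dev_bound: "\<bar>dev x\<bar> \<le> 1 * (1 + norm x ^ 2)"
proof -
  have "\<bar>dev x\<bar> \<le> 1 + norm x ^ 2" using zero_le_power2[of "norm x"] unfolding dev_def by linarith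
  then show ?thesis by simp
qed

lemma quad_growth_dev: "quad_growth (\<lambda>z. dev (fst z))" "quad_growth (\<lambda>z. dev (snd z))"
  by (rule quad_growth_fst quad_growth_snd, measurable, rule dev_bound)+

lemma dev_integral: "(\<integral>x. dev x \<partial>Q) = 0"
proof -
  have "integrable Q (\<lambda>x. norm x ^ 2)" by (rule integrable_quadratic[where C = 1]) auto
  then show ?thesis by (simp add: dev_def second_moment prob_space)
qed

lemma dist_sq: "(norm (x - y))\<^sup>2 = 1 + dev x + dev y - 2 * (x \<bullet> y)"
  by (simp add: dev_def power2_norm_eq_inner inner_diff_left inner_diff_right inner_commute)

lemma integrable_cubic_min:
  assumes "quad_growth f"
  shows "integrable Q2 (\<lambda>z. cubic_min (f z))"
proof (rule Bochner_Integration.integrable_bound[OF integrable_product[OF assms assms]])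
  show "(\<lambda>z. cubic_min (f z)) \<in> borel_measurable Q2" using quad_growth_meas[OF assms] by measurable
  show "AE z in Q2. norm (cubic_min (f z)) \<le> norm (f z * f z)"
    by (auto simp: cubic_min_def power2_eq_square)
qed

text \<open>The common right-hand side of \<open>pointwise_upper\<close> and
  \<open>pointwise_lower\<close>. Splitting 9 evenly between the two deviations is harmless, as they
  have the same law.\<close>

definition remainder :: "'a \<times> 'a \<Rightarrow> real" where
  "remainder z = 9/2 * cubic_min (dev (fst z)) + 9/2 * cubic_min (dev (snd z))
    + 9 * cubic_min (fst z \<bullet> snd z)"

lemma remainder_integrable: "integrable Q2 remainder"
  unfolding remainder_def [abs_def]
  using integrable_cubic_min[OF quad_growth_dev(1)] integrable_cubic_min[OF quad_growth_dev(2)]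
    integrable_cubic_min[OF quad_growth_inner] by simp

lemma remainder_integral:
  "(\<integral>z. remainder z \<partial>Q2)
    = 9 * ((\<integral>x. cubic_min (dev x) \<partial>Q) + (\<integral>z. cubic_min (fst z \<bullet> snd z) \<partial>Q2))"
proof -
  note i = integrable_cubic_min[OF quad_growth_dev(1)] integrable_cubic_min[OF quad_growth_dev(2)]
    integrable_cubic_min[OF quad_growth_inner]
  have 1: "(\<integral>z. cubic_min (dev (fst z)) \<partial>Q2) = (\<integral>x. cubic_min (dev x) \<partial>Q)"
    using pair.integral_fst'[OF i(1)] by (simp add: prob_space)
  have "integrable Q2 (\<lambda>(x, y). cubic_min (dev y))" using i(2) by (simp add: case_prod_beta')
  from pair.integral_snd[OF this]
  have 2: "(\<integral>z. cubic_min (dev (snd z)) \<partial>Q2) = (\<integral>x. cubic_min (dev x) \<partial>Q)"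
    by (simp add: prob_space case_prod_beta')
  show ?thesis unfolding remainder_def using i by (simp add: 1 2)
qed

lemma centered_upper:
  "(\<integral>z. (centered z)\<^sup>2 \<partial>Q2) - (\<integral>z. (fst z \<bullet> snd z)\<^sup>2 \<partial>Q2) \<le> (\<integral>z. remainder z \<partial>Q2)"
proof -
  define p where "p z = fst z \<bullet> snd z" for z :: "'a \<times> 'a"
  define \<phi> where "\<phi> x = 1/2 + dev x / 2 - corr (dev x)" for x
  define h where "h z = norm (fst z - snd z) - \<phi> (fst z) - \<phi> (snd z)" for z
  define e where "e z = - h z - p z" for z
  \<comment> \<open>Each product pairs a mean-zero deviation of one variable with a function of the
    other, so the integral vanishes and adding \<open>2 * T\<close> is free.\<close>
  define T where "T z = dev (snd z) * neg_sq (dev (fst z)) + dev (fst z) * neg_sq (dev (snd z))" for z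
  have \<phi> [measurable]: "\<phi> \<in> borel_measurable borel" unfolding \<phi>_def by measurable
  have \<phi>b: "\<bar>\<phi> x\<bar> \<le> 2 * (1 + norm x ^ 2)" for x
  proof -
    have "\<bar>\<phi> x\<bar> \<le> 1/2 + \<bar>dev x\<bar> / 2 + \<bar>corr (dev x)\<bar>" unfolding \<phi>_def by linarith
    then have "\<bar>\<phi> x\<bar> \<le> 2 + 2 * norm x ^ 2"
      using dev_bound[of x] corr_bound[OF dev_ge[of x]] zero_le_power2[of "norm x"]
      unfolding mult_1 by linarith
    then show ?thesis by simp
  qed
  have qp: "quad_growth p" unfolding p_def [abs_def] by (rule quad_growth_inner)
  have qh: "quad_growth h" unfolding h_def [abs_def]
    by (intro quad_growth_diff quad_growth_dist quad_growth_fst[OF \<phi> \<phi>b] quad_growth_snd[OF \<phi> \<phi>b])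
  have qe: "quad_growth e" unfolding e_def [abs_def] by (intro quad_growth_diff quad_growth_minus qh qp)
  have nb: "\<bar>neg_sq (dev x)\<bar> \<le> 1 * (1 + norm x ^ 2)" for x
    using neg_sq_bound[OF dev_ge[of x]] zero_le_power2[of "norm x"] unfolding mult_1 by linarith
  have qn: "quad_growth (\<lambda>z. neg_sq (dev (fst z)))" "quad_growth (\<lambda>z. neg_sq (dev (snd z)))"
    by (rule quad_growth_fst[where a = "\<lambda>x. neg_sq (dev x)"]
        quad_growth_snd[where a = "\<lambda>x. neg_sq (dev x)"], measurable, rule nb)+
  have iT: "integrable Q2 T" unfolding T_def [abs_def]
    by (intro Bochner_Integration.integrable_add integrable_product quad_growth_dev qn)
  have T0: "(\<integral>z. T z \<partial>Q2) = 0"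
    unfolding T_def
    using orthogonal_fst[where a = "\<lambda>x. neg_sq (dev x)", OF quad_growth_dev(2) qn(1)]
      orthogonal_snd[where a = "\<lambda>x. neg_sq (dev x)", OF quad_growth_dev(1) qn(2)]
      integrable_product[OF quad_growth_dev(2) qn(1)] integrable_product[OF quad_growth_dev(1) qn(2)]
    by (simp add: dev_integral)
  have ie: "integrable Q2 (\<lambda>z. e z * (2 * p z + e z))"
    by (intro integrable_product quad_growth_add quad_growth_cmult qe qp)
  have "e z * (2 * p z + e z) + 2 * T z \<le> remainder z" for z
  proof -
    obtain x y where z: "z = (x, y)" by (cases z)
    have "(1 - norm (x - y))\<^sup>2 / 2 = 1 - norm (x - y) + (dev x + dev y) / 2 - x \<bullet> y"
      using dist_sq[of x y] by (simp add: power2_diff field_simps)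
    then have "e z = (1 - norm (x - y))\<^sup>2 / 2 - corr (dev x) - corr (dev y)"
      by (simp add: e_def h_def p_def z \<phi>_def field_simps)
    then show ?thesis
      using pointwise_upper[OF norm_ge_zero dist_sq dev_ge dev_ge, of x y]
      by (simp add: z p_def T_def remainder_def ac_simps)
  qed
  then have "(\<integral>z. e z * (2 * p z + e z) + 2 * T z \<partial>Q2) \<le> (\<integral>z. remainder z \<partial>Q2)"
    using ie iT by (intro integral_mono remainder_integrable) auto
  then have E: "(\<integral>z. e z * (2 * p z + e z) \<partial>Q2) \<le> (\<integral>z. remainder z \<partial>Q2)"
    using ie iT T0 by simp
  have "(\<integral>z. (h z)\<^sup>2 \<partial>Q2) = (\<integral>z. p z * p z + e z * (2 * p z + e z) \<partial>Q2)"
    by (rule Bochner_Integration.integral_cong) (auto simp: e_def power2_eq_square algebra_simps)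
  also have "\<dots> = (\<integral>z. (p z)\<^sup>2 \<partial>Q2) + (\<integral>z. e z * (2 * p z + e z) \<partial>Q2)"
    using ie integrable_product[OF qp qp] by (simp add: power2_eq_square)
  finally show ?thesis
    using centered_sq_le[OF \<phi> \<phi>b] E by (simp add: h_def p_def)
qed

lemma centered_lower:
  "- (\<integral>z. remainder z \<partial>Q2) \<le> (\<integral>z. (centered z)\<^sup>2 \<partial>Q2) - (\<integral>z. (fst z \<bullet> snd z)\<^sup>2 \<partial>Q2)"
proof -
  define p where "p z = fst z \<bullet> snd z" for z :: "'a \<times> 'a"
  define a where "a x = 1 + dev x - 2 * mean_dist x + (\<integral>x. mean_dist x \<partial>Q)" for x
  define W where "W z = (1 - norm (fst z - snd z))\<^sup>2" for z :: "'a \<times> 'a"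
  have qp: "quad_growth p" unfolding p_def [abs_def] by (rule quad_growth_inner)
  have qa: "quad_growth (\<lambda>z. a (fst z))" "quad_growth (\<lambda>z. a (snd z))"
    unfolding a_def by (intro quad_growth_add quad_growth_diff quad_growth_cmult quad_growth_dev
        quad_growth_mean_dist quad_growth_const)+
  \<comment> \<open>Up to functions of one variable, \<open>W\<close> is
    \<open>- 2 * (centered + p)\<close>. As \<open>p\<close> is orthogonal to such functions,
    \<open>p * W\<close> integrates like \<open>- 2 * p * (centered + p)\<close>.\<close>
  have W: "W z = a (fst z) + a (snd z) - 2 * (centered z + p z)" for z
    using dist_sq[of "fst z" "snd z"] by (simp add: W_def a_def centered_def p_def power2_diff)
  have qW: "quad_growth W" unfolding W [abs_def]
    by (intro quad_growth_add quad_growth_diff quad_growth_cmult quad_growth_centered qa qp)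
  have pz: "(\<integral>y. p (x, y) \<partial>Q) = 0" "(\<integral>y. p (y, x) \<partial>Q) = 0" for x
    by (simp_all add: p_def inner_integral[OF mean0])
  note i = integrable_product[OF qp qa(1)] integrable_product[OF qp qa(2)]
    integrable_product[OF qp qW] integrable_product[OF qp qp]
    integrable_product[OF quad_growth_centered quad_growth_centered]
  have sq: "(\<integral>z. centered z * centered z - p z * p z - p z * W z + p z * a (fst z) + p z * a (snd z) \<partial>Q2)
      = (\<integral>z. (centered z + p z)\<^sup>2 \<partial>Q2)"
    by (rule Bochner_Integration.integral_cong) (auto simp: W power2_eq_square algebra_simps)
  have "(\<integral>z. centered z * centered z - p z * p z - p z * W z + p z * a (fst z) + p z * a (snd z) \<partial>Q2)
      = (\<integral>z. centered z * centered z \<partial>Q2) - (\<integral>z. p z * p z \<partial>Q2) - (\<integral>z. p z * W z \<partial>Q2)"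
    using i orthogonal_fst[OF qp qa(1) pz(1)] orthogonal_snd[OF qp qa(2) pz(2)] by simp
  moreover have "0 \<le> (\<integral>z. (centered z + p z)\<^sup>2 \<partial>Q2)" by simp
  ultimately have "(\<integral>z. p z * W z \<partial>Q2) \<le> (\<integral>z. centered z * centered z \<partial>Q2) - (\<integral>z. p z * p z \<partial>Q2)"
    using sq by linarith
  moreover have "(\<integral>z. - (p z * W z) \<partial>Q2) \<le> (\<integral>z. remainder z \<partial>Q2)"
  proof (intro integral_mono remainder_integrable)
    show "- (p z * W z) \<le> remainder z" for z
      using pointwise_lower[OF norm_ge_zero dist_sq dev_ge dev_ge, of "fst z" "snd z"]
      by (simp add: p_def W_def remainder_def)
  qed (use i in auto)
  ultimately show ?thesis using i by (simp add: p_def power2_eq_square)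
qed

lemma centered_sq_approx:
  "\<bar>(\<integral>z. (centered z)\<^sup>2 \<partial>Q2) - (\<integral>z. (fst z \<bullet> snd z)\<^sup>2 \<partial>Q2)\<bar>
    \<le> 9 * ((\<integral>x. cubic_min (dev x) \<partial>Q) + (\<integral>z. cubic_min (fst z \<bullet> snd z) \<partial>Q2))"
  using centered_upper centered_lower remainder_integral by linarith

end


section \<open>Rescaling\<close>

lemma cubic_min_le_powr:
  assumes "2 \<le> q" "q \<le> 3"
  shows "cubic_min x \<le> \<bar>x\<bar> powr q"
proof (cases "\<bar>x\<bar> \<le> 1")
  case True
  show ?thesis
  proof (cases "x = 0")
    case False
    then have "\<bar>x\<bar> ^ 3 = \<bar>x\<bar> powr 3" by simp
    also have "\<dots> \<le> \<bar>x\<bar> powr q" using assms True by (intro powr_mono') auto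
    finally show ?thesis using True by (simp add: cubic_min_small)
  qed (simp add: cubic_min_def)
next
  case False
  then have "x\<^sup>2 = \<bar>x\<bar> powr 2" by simp
  also have "\<dots> \<le> \<bar>x\<bar> powr q" using assms False by (intro powr_mono) auto
  finally show ?thesis using False by (simp add: cubic_min_large)
qed

lemma sq_powr: "0 \<le> (r::real) \<Longrightarrow> (r\<^sup>2) powr q = r powr (2 * q)"
  by (cases "r = 0") (auto simp: powr_powr simp flip: powr_numeral)

text \<open>Serves to dominate the integrands of \<open>moment_L\<close> by moments of the
  norm.\<close>

lemma max_powr_le:
  fixes a b q :: real
  assumes "0 \<le> a" "0 \<le> b" "0 \<le> q" "0 \<le> t" "t \<le> max a b"
  shows "t powr q \<le> a powr q + b powr q"
proof -
  have "t powr q \<le> (max a b) powr q" using assms by (intro powr_mono2) auto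
  also have "\<dots> \<le> a powr q + b powr q" by (auto simp: max_def)
  finally show ?thesis .
qed

lemma quartic_prob_distr:
  fixes X :: "'a \<Rightarrow> 'c::euclidean_space"
  assumes "prob_space M" and X [measurable]: "X \<in> borel_measurable M" and "4 \<le> r"
    and int: "integrable M (\<lambda>\<omega>. norm (X \<omega>) powr r)"
  shows "quartic_prob (distr M borel (\<lambda>\<omega>. c *\<^sub>R X \<omega>))"
proof -
  interpret prob_space M by fact
  interpret D: prob_space "distr M borel (\<lambda>\<omega>. c *\<^sub>R X \<omega>)" by (rule prob_space_distr) simp
  have i: "integrable M (\<lambda>\<omega>. norm (X \<omega>) ^ 4)"
  proof (rule Bochner_Integration.integrable_bound[of M "\<lambda>\<omega>. 1 + norm (X \<omega>) powr r"])
    show "AE \<omega> in M. norm (norm (X \<omega>) ^ 4) \<le> norm (1 + norm (X \<omega>) powr r)"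
    proof (rule AE_I2)
      fix \<omega>
      show "norm (norm (X \<omega>) ^ 4) \<le> norm (1 + norm (X \<omega>) powr r)"
      proof (cases "norm (X \<omega>) \<le> 1")
        case True
        then have "norm (X \<omega>) ^ 4 \<le> 1" by (simp add: power_le_one)
        then show ?thesis by (simp add: add_increasing2)
      next
        case False
        then have "norm (X \<omega>) ^ 4 = norm (X \<omega>) powr 4" by (subst powr_numeral) auto
        also have "\<dots> \<le> norm (X \<omega>) powr r" using False assms by (intro powr_mono) auto
        finally show ?thesis by simp
      qed
    qed
  qed (use int in auto)
  show ?thesis
  proof unfold_locales
    show "integrable (distr M borel (\<lambda>\<omega>. c *\<^sub>R X \<omega>)) (\<lambda>x. norm x ^ 4)"
      using i by (subst integrable_distr_eq) (auto simp: power_mult_distrib)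
  qed simp
qed

text \<open>With \<open>c = 1 / sqrt B\<close> the centered distance scales by
  \<open>sqrt B\<close>, so the normalized estimate gets multiplied by \<open>B\<close>. Rescaling
  inside \<open>cubic_min\<close> yields \<open>B powr (- q)\<close> with
  \<open>q = 2 + 2 * \<tau>\<close>, and \<open>1 - q = - (1 + 2 * \<tau>)\<close> is the final
  exponent.\<close>

theorem proposition5:
  fixes M :: "'a measure" and X :: "'a \<Rightarrow> real ^ 'p"
    and N :: "'b measure" and X1 X2 :: "'b \<Rightarrow> real ^ 'p"
    and \<tau> :: real
  assumes "prob_space M"
    and "X \<in> borel_measurable M"
    and "iid_copies M X N X1 X2"
    and "0 < \<tau>" and "\<tau> \<le> 1 / 2"
    and "integrable M (\<lambda>\<omega>. norm (X \<omega>) powr (4 + 4 * \<tau>))"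
    and "integral\<^sup>L M X = 0"
    and "\<not> (AE \<omega> in M. X \<omega> = 0)"
  shows "\<bar>dist_variance_sq N X1 X2
           - inverse (mean_sq_dist N X1 X2) * (\<integral>\<omega>. (X1 \<omega> \<bullet> X2 \<omega>)\<^sup>2 \<partial>N)\<bar>
         \<le> 9 * mean_sq_dist N X1 X2 powr (- (1 + 2 * \<tau>)) * moment_L M X N X1 X2 \<tau>"
proof -
  note X [measurable] = assms(2)
  interpret M: prob_space M by fact
  interpret N: prob_space N using assms(3) by (simp add: iid_copies_def)
  have ind: "N.indep_var borel X1 borel X2" and d1: "distr N borel X1 = distr M borel X"
    and d2: "distr N borel X2 = distr M borel X"
    using assms(3) by (simp_all add: iid_copies_def)
  have [measurable]: "X1 \<in> borel_measurable N" "X2 \<in> borel_measurable N"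
    using ind by (auto dest: N.indep_var_rv1 N.indep_var_rv2)
  \<comment> \<open>\<open>law 1\<close> serves the unscaled moments, \<open>law c\<close> the
    normalized argument.\<close>
  define law where "law c = distr M borel (\<lambda>\<omega>. c *\<^sub>R X \<omega>)" for c
  have law_prob: "quartic_prob (law c)" for c
    unfolding law_def by (rule quartic_prob_distr[OF assms(1,2) _ assms(6)]) (use assms(4) in simp)
  have law_integral: "(\<integral>x. f x \<partial>law c) = (\<integral>\<omega>. f (c *\<^sub>R X \<omega>) \<partial>M)"
    if [measurable]: "f \<in> borel_measurable borel" for c and f :: "_ \<Rightarrow> 'e::{banach, second_countable_topology}"
    unfolding law_def by (rule integral_distr) auto
  have scaled: "distr N borel (\<lambda>\<omega>. c *\<^sub>R Y \<omega>) = law c"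
    if "distr N borel Y = distr M borel X" and [measurable]: "Y \<in> borel_measurable N" for c Y
  proof -
    have "distr N borel (\<lambda>\<omega>. c *\<^sub>R Y \<omega>) = distr (distr N borel Y) borel ((*\<^sub>R) c)"
      by (subst distr_distr) (auto simp: comp_def)
    also have "\<dots> = law c" unfolding that(1) law_def by (subst distr_distr) (auto simp: comp_def)
    finally show ?thesis .
  qed
  have joint: "law c \<Otimes>\<^sub>M law c = distr N (borel \<Otimes>\<^sub>M borel) (\<lambda>\<omega>. (c *\<^sub>R X1 \<omega>, c *\<^sub>R X2 \<omega>))" for c
  proof -
    have "N.indep_var borel ((*\<^sub>R) c \<circ> X1) borel ((*\<^sub>R) c \<circ> X2)"
      by (rule N.indep_var_compose[OF ind]) auto
    from indep_var_joint_distr[OF N.prob_space_axioms this] show ?thesis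
      using scaled[OF d1, of c] scaled[OF d2, of c] by (simp add: comp_def)
  qed
  have joint_integral: "(\<integral>z. f z \<partial>(law c \<Otimes>\<^sub>M law c)) = (\<integral>\<omega>. f (c *\<^sub>R X1 \<omega>, c *\<^sub>R X2 \<omega>) \<partial>N)"
    if [measurable]: "f \<in> borel_measurable (borel \<Otimes>\<^sub>M borel)" for c and f :: "_ \<Rightarrow> real"
    unfolding joint by (rule integral_distr) auto

  define B where "B = mean_sq_dist N X1 X2"
  define m where "m = (\<integral>\<omega>. (norm (X \<omega>))\<^sup>2 \<partial>M)"
  interpret P: quartic_prob "law 1" by (rule law_prob)
  have "(\<integral>x. x \<partial>law 1) = 0" using assms(7) by (simp add: law_integral)
  from P.integral_dist_sq[OF this] have Bm: "B = 2 * m"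
    by (simp add: joint_integral law_integral B_def m_def mean_sq_dist_def)
  have Xsq: "integrable M (\<lambda>\<omega>. (norm (X \<omega>))\<^sup>2)"
  proof -
    have "integrable (law 1) (\<lambda>x. (norm x)\<^sup>2)" by (rule P.integrable_quadratic[where C = 1]) auto
    then show ?thesis unfolding law_def by (subst (asm) integrable_distr_eq) auto
  qed
  \<comment> \<open>That \<open>X\<close> is not almost surely zero enters here and makes the
    scaling factor \<open>B\<close> positive.\<close>
  have "m \<noteq> 0" using integral_nonneg_eq_0_iff_AE[OF Xsq] assms(8) by (auto simp: m_def)
  then have m0: "0 < m" by (simp add: m_def less_le)
  then have B0: "0 < B" by (simp add: Bm)

  define c where "c = 1 / sqrt B"
  have c0: "0 < c" and c2: "c\<^sup>2 = 1 / B" and cB: "sqrt B * c = 1"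
    using B0 by (simp_all add: c_def power_divide)
  interpret Q: quartic_prob "law c" by (rule law_prob)
  interpret Q: normalized_prob "law c"
  proof unfold_locales
    show "(\<integral>x. x \<partial>law c) = 0" using assms(7) by (simp add: law_integral)
    have "(\<integral>x. (norm x)\<^sup>2 \<partial>law c) = c\<^sup>2 * m"
      by (simp add: law_integral power_mult_distrib m_def)
    then show "(\<integral>x. (norm x)\<^sup>2 \<partial>law c) = 1/2" using Bm B0 by (simp add: c2)
  qed

  have norm_scale: "norm (x - y) = sqrt B * norm (c *\<^sub>R x - c *\<^sub>R y)" for x y :: "real ^ 'p"
  proof -
    have "norm (c *\<^sub>R x - c *\<^sub>R y) = c * norm (x - y)"
      using c0 by (simp flip: scaleR_diff_right)
    then show ?thesis using cB by (simp flip: mult.assoc)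
  qed
  have dist_int: "integrable N (\<lambda>\<omega>. norm (X1 \<omega> - X2 \<omega>))"
  proof -
    have "integrable (law 1 \<Otimes>\<^sub>M law 1) (\<lambda>z. norm (fst z - snd z))"
      by (rule P.quad_growth_integrable[OF P.quad_growth_dist])
    then show ?thesis unfolding joint by (subst (asm) integrable_distr_eq) auto
  qed
  have mean_dist: "(\<integral>y. norm (x - y) \<partial>distr M borel X) = sqrt B * Q.mean_dist (c *\<^sub>R x)" for x
  proof -
    have "(\<integral>y. norm (x - y) \<partial>distr M borel X) = (\<integral>\<omega>. norm (x - X \<omega>) \<partial>M)" by (rule integral_distr) auto
    also have "\<dots> = (\<integral>\<omega>. sqrt B * norm (c *\<^sub>R x - c *\<^sub>R X \<omega>) \<partial>M)" by (simp only: norm_scale[symmetric])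
    also have "\<dots> = sqrt B * Q.mean_dist (c *\<^sub>R x)" by (simp add: Q.mean_dist_def law_integral)
    finally show ?thesis .
  qed
  have grand_mean: "(\<integral>\<omega>. norm (X1 \<omega> - X2 \<omega>) \<partial>N) = sqrt B * (\<integral>x. Q.mean_dist x \<partial>law c)"
  proof -
    have "(\<integral>x. Q.mean_dist x \<partial>law c) = (\<integral>z. norm (fst z - snd z) \<partial>(law c \<Otimes>\<^sub>M law c))"
      using Q.pair.integral_fst'[OF Q.quad_growth_integrable[OF Q.quad_growth_dist]]
      by (simp add: Q.mean_dist_def)
    also have "\<dots> = (\<integral>\<omega>. norm (c *\<^sub>R X1 \<omega> - c *\<^sub>R X2 \<omega>) \<partial>N)" by (simp add: joint_integral)
    finally have "sqrt B * (\<integral>x. Q.mean_dist x \<partial>law c)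
        = (\<integral>\<omega>. sqrt B * norm (c *\<^sub>R X1 \<omega> - c *\<^sub>R X2 \<omega>) \<partial>N)" by simp
    then show ?thesis by (simp only: norm_scale[symmetric])
  qed
  have ce1: "AE \<omega> in N. cond_exp_given N X1 (\<lambda>\<omega>. norm (X1 \<omega> - X2 \<omega>)) \<omega> = sqrt B * Q.mean_dist (c *\<^sub>R X1 \<omega>)"
    using cond_exp_given_indep[OF N.prob_space_axioms ind, of "\<lambda>z. norm (fst z - snd z)"] dist_int
    by (simp add: d2 mean_dist)
  have ce2: "AE \<omega> in N. cond_exp_given N X2 (\<lambda>\<omega>. norm (X1 \<omega> - X2 \<omega>)) \<omega> = sqrt B * Q.mean_dist (c *\<^sub>R X2 \<omega>)"
    using cond_exp_given_indep[OF N.prob_space_axioms indep_var_swap[OF N.prob_space_axioms ind],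
        of "\<lambda>z. norm (snd z - fst z)"] dist_int
    by (simp add: d1 norm_minus_commute[of _ "X2 _"] mean_dist)
  have "AE \<omega> in N. (centered_dist N X1 X2 \<omega>)\<^sup>2 = B * (Q.centered (c *\<^sub>R X1 \<omega>, c *\<^sub>R X2 \<omega>))\<^sup>2"
    using ce1 ce2
  proof eventually_elim
    case (elim \<omega>)
    have "centered_dist N X1 X2 \<omega> = sqrt B * Q.centered (c *\<^sub>R X1 \<omega>, c *\<^sub>R X2 \<omega>)"
      unfolding centered_dist_def elim grand_mean Q.centered_def norm_scale[of "X1 \<omega>" "X2 \<omega>"]
      by (simp add: algebra_simps)
    then show ?case using B0 by (simp add: power_mult_distrib)
  qed
  \<comment> \<open>Almost everywhere equality is transferred to the integrals by a rule for
    measurable integrands, hence these two facts.\<close>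
  moreover have centered [measurable]: "Q.centered \<in> borel_measurable (borel \<Otimes>\<^sub>M borel)"
    unfolding Q.centered_def [abs_def] by measurable
  moreover have "centered_dist N X1 X2 \<in> borel_measurable N"
    unfolding centered_dist_def [abs_def] cond_exp_given_def by measurable
  ultimately have "dist_variance_sq N X1 X2 = (\<integral>\<omega>. B * (Q.centered (c *\<^sub>R X1 \<omega>, c *\<^sub>R X2 \<omega>))\<^sup>2 \<partial>N)"
    unfolding dist_variance_sq_def by (intro integral_cong_AE) auto
  then have V: "dist_variance_sq N X1 X2 = B * (\<integral>z. (Q.centered z)\<^sup>2 \<partial>(law c \<Otimes>\<^sub>M law c))"
    by (simp add: joint_integral)
  have "(\<integral>z. (fst z \<bullet> snd z)\<^sup>2 \<partial>(law c \<Otimes>\<^sub>M law c)) = (\<integral>\<omega>. (c\<^sup>2)\<^sup>2 * (X1 \<omega> \<bullet> X2 \<omega>)\<^sup>2 \<partial>N)"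
    by (simp add: joint_integral power_mult_distrib power2_eq_square ac_simps)
  also have "\<dots> = (1 / B)\<^sup>2 * (\<integral>\<omega>. (X1 \<omega> \<bullet> X2 \<omega>)\<^sup>2 \<partial>N)" by (simp add: c2)
  finally have S: "inverse B * (\<integral>\<omega>. (X1 \<omega> \<bullet> X2 \<omega>)\<^sup>2 \<partial>N)
      = B * (\<integral>z. (fst z \<bullet> snd z)\<^sup>2 \<partial>(law c \<Otimes>\<^sub>M law c))"
    using B0 by (simp add: power2_eq_square field_simps)

  define q where "q = 2 + 2 * \<tau>"
  have q: "2 \<le> q" "q \<le> 3" using assms(4,5) by (auto simp: q_def)
  have q2: "2 * q = 4 + 4 * \<tau>" by (simp add: q_def)
  have cm: "cubic_min (x / B) \<le> B powr (- q) * \<bar>x\<bar> powr q" for x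
    using cubic_min_le_powr[OF q, of "x / B"] B0 by (simp add: powr_divide powr_minus_divide)
  have XN: "integrable N (\<lambda>\<omega>. norm (Y \<omega>) powr (2 * q))"
    if "distr N borel Y = distr M borel X" and [measurable]: "Y \<in> borel_measurable N" for Y
  proof -
    have "integrable (distr M borel X) (\<lambda>x. norm x powr (2 * q))"
      using assms(6) unfolding q2 by (subst integrable_distr_eq) auto
    then show ?thesis unfolding that(1)[symmetric] by (subst (asm) integrable_distr_eq) auto
  qed
  \<comment> \<open>Integrability of the majorant matters: otherwise its Bochner integral would
    default to 0 and could not serve as an upper bound. The assumed moment of order
    \<open>2 * q = 4 + 4 * \<tau>\<close> is what provides it.\<close>
  have iU: "integrable M (\<lambda>\<omega>. \<bar>(norm (X \<omega>))\<^sup>2 - m\<bar> powr q)"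
  proof (rule Bochner_Integration.integrable_bound)
    show "integrable M (\<lambda>\<omega>. norm (X \<omega>) powr (2 * q) + m powr q)" using assms(6) by (simp add: q2)
    have "\<bar>(norm (X \<omega>))\<^sup>2 - m\<bar> powr q \<le> ((norm (X \<omega>))\<^sup>2) powr q + m powr q" for \<omega>
      using m0 q by (intro max_powr_le) (auto simp: max_def abs_if)
    then show "AE \<omega> in M. norm (\<bar>(norm (X \<omega>))\<^sup>2 - m\<bar> powr q) \<le> norm (norm (X \<omega>) powr (2 * q) + m powr q)"
      by (simp add: sq_powr)
  qed measurable
  have iP: "integrable N (\<lambda>\<omega>. \<bar>X1 \<omega> \<bullet> X2 \<omega>\<bar> powr q)"
  proof (rule Bochner_Integration.integrable_bound)
    show "integrable N (\<lambda>\<omega>. norm (X1 \<omega>) powr (2 * q) + norm (X2 \<omega>) powr (2 * q))"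
      using XN[OF d1] XN[OF d2] by simp
    have "\<bar>X1 \<omega> \<bullet> X2 \<omega>\<bar> powr q \<le> ((norm (X1 \<omega>))\<^sup>2) powr q + ((norm (X2 \<omega>))\<^sup>2) powr q" for \<omega>
    proof (rule max_powr_le)
      have "2 * \<bar>X1 \<omega> \<bullet> X2 \<omega>\<bar> \<le> (norm (X1 \<omega>))\<^sup>2 + (norm (X2 \<omega>))\<^sup>2"
        using Cauchy_Schwarz_ineq2[of "X1 \<omega>" "X2 \<omega>"]
          sum_squares_bound[of "norm (X1 \<omega>)" "norm (X2 \<omega>)"] by (simp add: mult.assoc)
      then show "\<bar>X1 \<omega> \<bullet> X2 \<omega>\<bar> \<le> max ((norm (X1 \<omega>))\<^sup>2) ((norm (X2 \<omega>))\<^sup>2)" by linarith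
    qed (use q in auto)
    then show "AE \<omega> in N. norm (\<bar>X1 \<omega> \<bullet> X2 \<omega>\<bar> powr q)
        \<le> norm (norm (X1 \<omega>) powr (2 * q) + norm (X2 \<omega>) powr (2 * q))"
      by (simp add: sq_powr)
  qed measurable
  have U: "(\<integral>x. cubic_min (Q.dev x) \<partial>law c) \<le> B powr (- q) * (\<integral>\<omega>. \<bar>(norm (X \<omega>))\<^sup>2 - m\<bar> powr q \<partial>M)"
  proof -
    have "Q.dev (c *\<^sub>R X \<omega>) = ((norm (X \<omega>))\<^sup>2 - m) / B" for \<omega>
      using B0 by (simp add: Q.dev_def power_mult_distrib c2 Bm field_simps)
    then have "(\<integral>x. cubic_min (Q.dev x) \<partial>law c) = (\<integral>\<omega>. cubic_min (((norm (X \<omega>))\<^sup>2 - m) / B) \<partial>M)"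
      by (simp add: law_integral)
    also have "\<dots> \<le> (\<integral>\<omega>. B powr (- q) * \<bar>(norm (X \<omega>))\<^sup>2 - m\<bar> powr q \<partial>M)"
      using iU by (intro integral_mono_AE' AE_I2 cm) auto
    finally show ?thesis by simp
  qed
  have P: "(\<integral>z. cubic_min (fst z \<bullet> snd z) \<partial>(law c \<Otimes>\<^sub>M law c))
      \<le> B powr (- q) * (\<integral>\<omega>. \<bar>X1 \<omega> \<bullet> X2 \<omega>\<bar> powr q \<partial>N)"
  proof -
    have "c *\<^sub>R x \<bullet> c *\<^sub>R y = (x \<bullet> y) / B" for x y :: "real ^ 'p"
      using c2 by (simp add: power2_eq_square flip: mult.assoc)
    then have "(\<integral>z. cubic_min (fst z \<bullet> snd z) \<partial>(law c \<Otimes>\<^sub>M law c)) = (\<integral>\<omega>. cubic_min ((X1 \<omega> \<bullet> X2 \<omega>) / B) \<partial>N)"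
      by (simp add: joint_integral)
    also have "\<dots> \<le> (\<integral>\<omega>. B powr (- q) * \<bar>X1 \<omega> \<bullet> X2 \<omega>\<bar> powr q \<partial>N)"
      using iP by (intro integral_mono_AE' AE_I2 cm) auto
    finally show ?thesis by simp
  qed
  have "\<bar>dist_variance_sq N X1 X2 - inverse B * (\<integral>\<omega>. (X1 \<omega> \<bullet> X2 \<omega>)\<^sup>2 \<partial>N)\<bar>
      = B * \<bar>(\<integral>z. (Q.centered z)\<^sup>2 \<partial>(law c \<Otimes>\<^sub>M law c)) - (\<integral>z. (fst z \<bullet> snd z)\<^sup>2 \<partial>(law c \<Otimes>\<^sub>M law c))\<bar>"
    unfolding V S using B0 by (simp add: abs_mult flip: right_diff_distrib)
  also have "\<dots> \<le> B * (9 * ((\<integral>x. cubic_min (Q.dev x) \<partial>law c)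
      + (\<integral>z. cubic_min (fst z \<bullet> snd z) \<partial>(law c \<Otimes>\<^sub>M law c))))"
    using B0 Q.centered_sq_approx by (intro mult_left_mono) auto
  also have "\<dots> \<le> B * (9 * (B powr (- q) * moment_L M X N X1 X2 \<tau>))"
    using U P B0 by (intro mult_left_mono) (auto simp: moment_L_def m_def q_def distrib_left)
  also have "\<dots> = 9 * (B * B powr (- q)) * moment_L M X N X1 X2 \<tau>" by simp
  also have "B * B powr (- q) = B powr (- (1 + 2 * \<tau>))"
    using B0 powr_add[of B 1 "- q"] by (simp add: q_def)
  finally show ?thesis by (simp add: B_def)
qed

end
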